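(* Contracted machines form a $\mathcal{W}_{\widetilde{\mathrm{Int}}}$-subalgebra of $\mathsf{Mch}\times\mathsf{Cntr}$. That is, the full subcategories $\mathsf{CM}(\widehat{X^{\mathrm{in}}},\widehat{X^{\mathrm{out}}})\subseteq\mathsf{Mch}(X)\times\mathsf{Cntr}(X)$ of contracted machines are preserved by the functors $\mathsf{Mch}(\phi)\times\mathsf{Cntr}(\phi)$ for all wiring diagrams $\phi$ and by the lax monoidal structure.
   Context: Interval sheaves. $\mathrm{Int}$ is the category with objects $\ell\in\mathbb{R}_{\ge0}$, morphisms $\ell'\to\ell$ the symbols $\mathrm{Tr}_p$ with $p\in\mathbb{R}_{\ge0}$, $p\le\ell-\ell'$, composition $\mathrm{Tr}_p\circ\mathrm{Tr}_{p'}=\mathrm{Tr}_{p+p'}$, identities $\mathrm{Tr}_0$. For a presheaf $X$ and $x\in X(\ell)$, write $x|_{[p,p+\ell']}=X(\mathrm{Tr}_p)(x)$. A continuous interval sheaf is a presheaf $X$ on $\mathrm{Int}$ such that for all $x_1\in X(\ell_1)$, $x_2\in X(\ell_2)$ with $x_1|_{[\ell_1,\ell_1]}=x_2|_{[0,0]}$ there is a unique element of $X(\ell_1+\ell_2)$ restricting to $x_1$ on $[0,\ell_1]$ and to $x_2$ on $[\ell_1,\ell_1+\ell_2]$. $\widetilde{\mathrm{Int}}$ is the topos of such sheaves and $U\colon\widetilde{\mathrm{Int}}\to\mathsf{Psh}(\mathrm{Int})$ the inclusion into presheaves. For $A,B\in\widetilde{\mathrm{Int}}$: a continuous $(A,B)$-machine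 is a sheaf map $p\colon S\to A\times B$, and $\mathsf{Mch}(A,B)=\widetilde{\mathrm{Int}}/(A\times B)$. A safety contract is a sub-presheaf $C\subseteq UA\times UB$, and $\mathsf{Cntr}(A,B)$ is the poset of these. A machine $p\colon S\to A\times B$ validates $C$, written $S\models C$, if $Up\colon US\to UA\times UB$ factors through $C$ (equivalently the presheaf image of $Up$ is contained in $C$). A contracted $(A,B)$-machine is a pair $(S,C)\in\mathsf{Mch}(A,B)\times\mathsf{Cntr}(A,B)$ with $S\models C$; these form the full subcategory $\mathsf{CM}(A,B)$ of $\mathsf{Mch}(A,B)\times\mathsf{Cntr}(A,B)$. Wiring diagrams, with $\mathcal{C}=\widetilde{\mathrm{Int}}$. A $\mathcal{C}$-typed finite set is a finite set $X$ with $\tau\colon X\to\mathrm{ob}\,\mathcal{C}$; typed functions preserve types; $\widehat{X}=\prod_{x\in X}\tau(x)$; a typed function $f\colon X\to X'$ induces $\widehat{f}\colon\widehat{X'}\to\widehat{X}$ by reindexing. $\mathcal{W}_{\mathcal{C}}$ is the symmetric monoidal category whose objects (boxes) are pairs $X=(X^{\mathrm{in}},X^{\mathrm{out}})$ of $\mathcal{C}$-typed finite sets and whose morphisms (wiring diagrams) $\phi\colon X\to Y$ are pairs of typed functions $\phi^{\mathrm{in}}\colon X^{\mathrm{in}}\to X^{\mathrm{out}}+Y^{\mathrm{in}}$, $\phi^{\mathrm{out}}\colon Y^{\mathrm{out}}\to X^{\mathrm{out}}$. The composite $\omega=\psi\circ\phi$ has $\omega^{\mathrm{out}}=\phi^{\mathrm{out}}\circ\psi^{\mathrm{out}}$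 and $\omega^{\mathrm{in}}=(\nabla+1)\circ(1+\phi^{\mathrm{out}}+1)\circ(1+\psi^{\mathrm{in}})\circ\phi^{\mathrm{in}}$; the identity is (coproduct inclusion, identity). The tensor $\oplus$ is componentwise disjoint union with unit $0=(\emptyset,\emptyset)$. $\phi$ induces $\widehat{\phi^{\mathrm{in}}}\colon\widehat{Y^{\mathrm{in}}}\times\widehat{X^{\mathrm{out}}}\to\widehat{X^{\mathrm{in}}}$ and $\widehat{\phi^{\mathrm{out}}}\colon\widehat{X^{\mathrm{out}}}\to\widehat{Y^{\mathrm{out}}}$. A $\mathcal{W}_{\mathcal{C}}$-algebra is a symmetric lax monoidal functor $(\mathcal{W}_{\mathcal{C}},\oplus,0)\to(\mathbf{Cat},\times,\mathbf{1})$ (in the pseudo sense: axioms up to coherent natural isomorphism). $\mathsf{Mch}(X)=\mathsf{Mch}(\widehat{X^{\mathrm{in}}},\widehat{X^{\mathrm{out}}})$, with $\mathsf{Mch}(\phi)$ pulling back a machine along $(\widehat{\phi^{\mathrm{in}}},\pi_2)\colon\widehat{Y^{\mathrm{in}}}\times\widehat{X^{\mathrm{out}}}\to\widehat{X^{\mathrm{in}}}\times\widehat{X^{\mathrm{out}}}$ and postcomposing with $1\times\widehat{\phi^{\mathrm{out}}}\colon\widehat{Y^{\mathrm{in}}}\times\widehat{X^{\mathrm{out}}}\to\widehat{Y^{\mathrm{in}}}\times\widehat{Y^{\mathrm{out}}}$. $\mathsf{Cntr}(X)=\mathsf{Cntr}(\widehat{X^{\mathrm{in}}},\widehat{X^{\mathrm{out}}})$,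 with $\mathsf{Cntr}(\phi)$ pulling back a sub-presheaf along $(\widehat{\phi^{\mathrm{in}}},\pi_2)$ and taking its presheaf image under $1\times\widehat{\phi^{\mathrm{out}}}$. Both lax structures are given by cartesian product. *)

theory Defs
  imports Complex_Main "HOL-Library.FuncSet"
begin

record ('o, 'm) cat =
  Ob :: "'o set"
  Hom :: "'o \<Rightarrow> 'o \<Rightarrow> 'm set"
  Idn :: "'o \<Rightarrow> 'm"
  Cmp :: "'o \<Rightarrow> 'o \<Rightarrow> 'o \<Rightarrow> 'm \<Rightarrow> 'm \<Rightarrow> 'm"

text \<open>\<open>Cmp C a b c g f\<close> is the composite \<open>g \<circ> f\<close> of \<open>f : a \<rightarrow> b\<close> and \<open>g : b \<rightarrow> c\<close>; the objects are
  arguments because the same element of type \<open>'m\<close> may lie in several hom-sets.\<close>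

locale category =
  fixes C :: "('o, 'm) cat"
  assumes Idn_closed: "a \<in> Ob C \<Longrightarrow> Idn C a \<in> Hom C a a"
    and Cmp_closed: "\<lbrakk>a \<in> Ob C; b \<in> Ob C; c \<in> Ob C; f \<in> Hom C a b; g \<in> Hom C b c\<rbrakk>
          \<Longrightarrow> Cmp C a b c g f \<in> Hom C a c"
    and Cmp_Idn: "\<lbrakk>a \<in> Ob C; b \<in> Ob C; f \<in> Hom C a b\<rbrakk> \<Longrightarrow> Cmp C a a b f (Idn C a) = f"
    and Idn_Cmp: "\<lbrakk>a \<in> Ob C; b \<in> Ob C; f \<in> Hom C a b\<rbrakk> \<Longrightarrow> Cmp C a b b (Idn C b) f = f"
    and Cmp_assoc: "\<lbrakk>a \<in> Ob C; b \<in> Ob C; c \<in> Ob C; d \<in> Ob C;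
            f \<in> Hom C a b; g \<in> Hom C b c; h \<in> Hom C c d\<rbrakk>
          \<Longrightarrow> Cmp C a b d (Cmp C b c d h g) f = Cmp C a c d h (Cmp C a b c g f)"

record ('o, 'm, 'p, 'n) fctr =
  fob :: "'o \<Rightarrow> 'p"
  fmap :: "'o \<Rightarrow> 'o \<Rightarrow> 'm \<Rightarrow> 'n"

locale is_functor = src: category C + tgt: category D
  for C :: "('o, 'm) cat" and D :: "('p, 'n) cat" +
  fixes F :: "('o, 'm, 'p, 'n) fctr"
  assumes fob_closed: "a \<in> Ob C \<Longrightarrow> fob F a \<in> Ob D"
    and fmap_closed: "\<lbrakk>a \<in> Ob C; b \<in> Ob C; f \<in> Hom C a b\<rbrakk>
          \<Longrightarrow> fmap F a b f \<in> Hom D (fob F a) (fob F b)"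
    and fmap_Idn: "a \<in> Ob C \<Longrightarrow> fmap F a a (Idn C a) = Idn D (fob F a)"
    and fmap_Cmp: "\<lbrakk>a \<in> Ob C; b \<in> Ob C; c \<in> Ob C; f \<in> Hom C a b; g \<in> Hom C b c\<rbrakk>
          \<Longrightarrow> fmap F a c (Cmp C a b c g f)
            = Cmp D (fob F a) (fob F b) (fob F c) (fmap F b c g) (fmap F a b f)"

definition full_subcat :: "('o, 'm) cat \<Rightarrow> ('o \<Rightarrow> bool) \<Rightarrow> ('o, 'm) cat" where
  "full_subcat C P = C\<lparr>Ob := {a \<in> Ob C. P a}\<rparr>"

definition prod_cat :: "('o, 'm) cat \<Rightarrow> ('p, 'n) cat \<Rightarrow> ('o \<times> 'p, 'm \<times> 'n) cat"
    (infixr "\<times>\<^sub>C" 80) where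
  "C \<times>\<^sub>C D = \<lparr>Ob = Ob C \<times> Ob D,
     Hom = (\<lambda>(a, a') (b, b'). Hom C a b \<times> Hom D a' b'),
     Idn = (\<lambda>(a, a'). (Idn C a, Idn D a')),
     Cmp = (\<lambda>(a, a') (b, b') (c, c') (g, g') (f, f'). (Cmp C a b c g f, Cmp D a' b' c' g' f'))\<rparr>"

definition one_cat :: "(unit, unit) cat" where
  "one_cat = \<lparr>Ob = {()}, Hom = (\<lambda>_ _. {()}), Idn = (\<lambda>_. ()), Cmp = (\<lambda>_ _ _ _ _. ())\<rparr>"

definition fcomp :: "('p, 'n, 'q, 'k) fctr \<Rightarrow> ('o, 'm, 'p, 'n) fctr \<Rightarrow> ('o, 'm, 'q, 'k) fctr" where
  "fcomp G F = \<lparr>fob = (\<lambda>a. fob G (fob F a)),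
     fmap = (\<lambda>a b f. fmap G (fob F a) (fob F b) (fmap F a b f))\<rparr>"

definition prod_fctr :: "('o, 'm, 'p, 'n) fctr \<Rightarrow> ('o', 'm', 'p', 'n') fctr
    \<Rightarrow> ('o \<times> 'o', 'm \<times> 'm', 'p \<times> 'p', 'n \<times> 'n') fctr" (infixr "\<times>\<^sub>F" 80) where
  "F \<times>\<^sub>F G = \<lparr>fob = (\<lambda>(a, a'). (fob F a, fob G a')),
     fmap = (\<lambda>(a, a') (b, b') (f, f'). (fmap F a b f, fmap G a' b' f'))\<rparr>"

definition pair_fctr :: "('o, 'm, 'p, 'n) fctr \<Rightarrow> ('o, 'm, 'q, 'k) fctr \<Rightarrow> ('o, 'm, 'p \<times> 'q, 'n \<times> 'k) fctr"
  where
  "pair_fctr F G = \<lparr>fob = (\<lambda>a. (fob F a, fob G a)), fmap = (\<lambda>a b f. (fmap F a b f, fmap G a b f))\<rparr>"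

definition interchange :: "(('o \<times> 'p) \<times> 'o' \<times> 'p', ('m \<times> 'n) \<times> 'm' \<times> 'n',
    ('o \<times> 'o') \<times> 'p \<times> 'p', ('m \<times> 'm') \<times> 'n \<times> 'n') fctr" where
  "interchange = \<lparr>fob = (\<lambda>((a, b), (a', b')). ((a, a'), (b, b'))),
     fmap = (\<lambda>_ _ ((f, g), (f', g')). ((f, f'), (g, g')))\<rparr>"

text \<open>The symbol \<open>Tr\<^sub>p : l' \<rightarrow> l\<close> is encoded by the number \<open>p\<close>.\<close>

definition Int_cat :: "(real, real) cat" where
  "Int_cat = \<lparr>Ob = {0..}, Hom = (\<lambda>l' l. {p. 0 \<le> p \<and> p \<le> l - l'}), Idn = (\<lambda>_. 0),
     Cmp = (\<lambda>_ _ _ p p'. p + p')\<rparr>"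

text \<open>\<open>restr X l' l p\<close> is the action \<open>X(l) \<rightarrow> X(l')\<close> of \<open>Tr\<^sub>p : l' \<rightarrow> l\<close>.\<close>

record 'a psh =
  sect :: "real \<Rightarrow> 'a set"
  restr :: "real \<Rightarrow> real \<Rightarrow> real \<Rightarrow> 'a \<Rightarrow> 'a"

definition presheaf :: "'a psh \<Rightarrow> bool" where
  "presheaf X \<longleftrightarrow>
     (\<forall>l' \<in> Ob Int_cat. \<forall>l \<in> Ob Int_cat. \<forall>p \<in> Hom Int_cat l' l. restr X l' l p \<in> sect X l \<rightarrow> sect X l') \<and>
     (\<forall>l \<in> Ob Int_cat. \<forall>x \<in> sect X l. restr X l l (Idn Int_cat l) x = x) \<and>
     (\<forall>l'' \<in> Ob Int_cat. \<forall>l' \<in> Ob Int_cat. \<forall>l \<in> Ob Int_cat.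
        \<forall>p' \<in> Hom Int_cat l'' l'. \<forall>p \<in> Hom Int_cat l' l. \<forall>x \<in> sect X l.
          restr X l'' l (Cmp Int_cat l'' l' l p p') x = restr X l'' l' p' (restr X l' l p x))"

definition int_sheaf :: "'a psh \<Rightarrow> bool" where
  "int_sheaf X \<longleftrightarrow> presheaf X \<and>
     (\<forall>l\<^sub>1 \<in> Ob Int_cat. \<forall>l\<^sub>2 \<in> Ob Int_cat. \<forall>x\<^sub>1 \<in> sect X l\<^sub>1. \<forall>x\<^sub>2 \<in> sect X l\<^sub>2.
        restr X 0 l\<^sub>1 l\<^sub>1 x\<^sub>1 = restr X 0 l\<^sub>2 0 x\<^sub>2 \<longrightarrow>
        (\<exists>!x. x \<in> sect X (l\<^sub>1 + l\<^sub>2) \<and>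
              restr X l\<^sub>1 (l\<^sub>1 + l\<^sub>2) 0 x = x\<^sub>1 \<and> restr X l\<^sub>2 (l\<^sub>1 + l\<^sub>2) l\<^sub>1 x = x\<^sub>2))"

text \<open>Natural transformations. All families of functions are extensional, so that equality of
  morphisms is equality in HOL. Sheaf maps are the same thing, sheaves being a full subcategory.\<close>

type_synonym ('a, 'b) pmap = "real \<Rightarrow> 'a \<Rightarrow> 'b"

definition psh_map :: "'a psh \<Rightarrow> 'b psh \<Rightarrow> ('a, 'b) pmap \<Rightarrow> bool" where
  "psh_map X Y f \<longleftrightarrow>
     f \<in> (\<Pi>\<^sub>E l \<in> Ob Int_cat. sect X l \<rightarrow>\<^sub>E sect Y l) \<and>
     (\<forall>l' \<in> Ob Int_cat. \<forall>l \<in> Ob Int_cat. \<forall>p \<in> Hom Int_cat l' l. \<forall>x \<in> sect X l.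
        f l' (restr X l' l p x) = restr Y l' l p (f l x))"

definition id_map :: "'a psh \<Rightarrow> ('a, 'a) pmap" where
  "id_map X = (\<lambda>l \<in> Ob Int_cat. \<lambda>x \<in> sect X l. x)"

definition comp_map :: "'a psh \<Rightarrow> ('b, 'c) pmap \<Rightarrow> ('a, 'b) pmap \<Rightarrow> ('a, 'c) pmap" where
  "comp_map X g f = (\<lambda>l \<in> Ob Int_cat. compose (sect X l) (g l) (f l))"

text \<open>Finite products in sheaves are computed as in presheaves, so one definition serves for both
  \<open>A \<times> B\<close> and \<open>UA \<times> UB\<close>.\<close>

definition one_psh :: "unit psh" where
  "one_psh = \<lparr>sect = (\<lambda>_. {()}), restr = (\<lambda>_ _ _ _. ())\<rparr>"

definition prod_psh :: "'a psh \<Rightarrow> 'b psh \<Rightarrow> ('a \<times> 'b) psh" (infixr "\<times>\<^sub>P" 80) where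
  "X \<times>\<^sub>P Y = \<lparr>sect = (\<lambda>l. sect X l \<times> sect Y l),
     restr = (\<lambda>l' l p. map_prod (restr X l' l p) (restr Y l' l p))\<rparr>"

definition prod_map :: "'a psh \<Rightarrow> 'b psh \<Rightarrow> ('a, 'c) pmap \<Rightarrow> ('b, 'd) pmap \<Rightarrow> ('a \<times> 'b, 'c \<times> 'd) pmap" where
  "prod_map X Y f g = (\<lambda>l \<in> Ob Int_cat. \<lambda>(x, y) \<in> sect (X \<times>\<^sub>P Y) l. (f l x, g l y))"

definition pullback :: "'s psh \<Rightarrow> 'w psh \<Rightarrow> ('s, 'z) pmap \<Rightarrow> ('w, 'z) pmap \<Rightarrow> ('s \<times> 'w) psh" where
  "pullback S W p h = \<lparr>sect = (\<lambda>l. {(s, w) \<in> sect (S \<times>\<^sub>P W) l. p l s = h l w}),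
     restr = restr (S \<times>\<^sub>P W)\<rparr>"

definition sub_presheaf :: "'z psh \<Rightarrow> (real \<Rightarrow> 'z set) \<Rightarrow> bool" where
  "sub_presheaf Z C \<longleftrightarrow>
     C \<in> (\<Pi>\<^sub>E l \<in> Ob Int_cat. Pow (sect Z l)) \<and>
     (\<forall>l' \<in> Ob Int_cat. \<forall>l \<in> Ob Int_cat. \<forall>p \<in> Hom Int_cat l' l. restr Z l' l p ` C l \<subseteq> C l')"

definition sub_psh :: "'z psh \<Rightarrow> (real \<Rightarrow> 'z set) \<Rightarrow> 'z psh" where
  "sub_psh Z C = \<lparr>sect = C, restr = restr Z\<rparr>"

type_synonym ('s, 'z) over = "'s psh \<times> ('s, 'z) pmap"
type_synonym 'z contract = "real \<Rightarrow> 'z set"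

text \<open>The slice of interval sheaves over \<open>Z\<close>, with total sheaves carried by the type \<open>'s\<close>.\<close>

definition slice :: "'z psh \<Rightarrow> (('s, 'z) over, ('s, 's) pmap) cat" where
  "slice Z = \<lparr>Ob = {(S, p). int_sheaf S \<and> psh_map S Z p},
     Hom = (\<lambda>(S, p) (T, q). {f. psh_map S T f \<and> comp_map S q f = p}),
     Idn = (\<lambda>(S, p). id_map S),
     Cmp = (\<lambda>(S, p) _ _ g f. comp_map S g f)\<rparr>"

definition Mch :: "'a psh \<Rightarrow> 'b psh \<Rightarrow> (('s, 'a \<times> 'b) over, ('s, 's) pmap) cat" where
  "Mch A B = slice (A \<times>\<^sub>P B)"

definition Cntr :: "'a psh \<Rightarrow> 'b psh \<Rightarrow> (('a \<times> 'b) contract, unit) cat" where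
  "Cntr A B = \<lparr>Ob = {C. sub_presheaf (A \<times>\<^sub>P B) C},
     Hom = (\<lambda>C D. {_. \<forall>l \<in> Ob Int_cat. C l \<subseteq> D l}),
     Idn = (\<lambda>_. ()),
     Cmp = (\<lambda>_ _ _ _ _. ())\<rparr>"

definition validates :: "'a psh \<Rightarrow> 'b psh \<Rightarrow> ('s, 'a \<times> 'b) over \<Rightarrow> ('a \<times> 'b) contract \<Rightarrow> bool" where
  "validates A B = (\<lambda>(S, p) C. \<exists>g. psh_map S (sub_psh (A \<times>\<^sub>P B) C) g \<and>
     p = comp_map S (id_map (sub_psh (A \<times>\<^sub>P B) C)) g)"

text \<open>Here \<open>id_map (sub_psh Z C)\<close> serves as the inclusion of \<open>C\<close> into \<open>Z\<close>.\<close>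

definition CM :: "'a psh \<Rightarrow> 'b psh
    \<Rightarrow> (('s, 'a \<times> 'b) over \<times> ('a \<times> 'b) contract, ('s, 's) pmap \<times> unit) cat" where
  "CM A B = full_subcat (Mch A B \<times>\<^sub>C Cntr A B) (\<lambda>(M, C). validates A B M C)"

text \<open>Base change along \<open>h : W \<rightarrow> Z\<close>, and postcomposition with (image under) \<open>g : W \<rightarrow> Z'\<close>.\<close>

definition slice_pull :: "'w psh \<Rightarrow> ('w, 'z) pmap
    \<Rightarrow> (('s, 'z) over, ('s, 's) pmap, ('s \<times> 'w, 'w) over, ('s \<times> 'w, 's \<times> 'w) pmap) fctr" where
  "slice_pull W h = \<lparr>
     fob = (\<lambda>(S, p). (pullback S W p h, \<lambda>l \<in> Ob Int_cat. \<lambda>(s, w) \<in> sect (pullback S W p h) l. w)),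
     fmap = (\<lambda>(S, p) _ f. \<lambda>l \<in> Ob Int_cat. \<lambda>(s, w) \<in> sect (pullback S W p h) l. (f l s, w))\<rparr>"

definition slice_post :: "('w, 'z) pmap
    \<Rightarrow> (('s, 'w) over, ('s, 's) pmap, ('s, 'z) over, ('s, 's) pmap) fctr" where
  "slice_post g = \<lparr>fob = (\<lambda>(S, p). (S, comp_map S g p)), fmap = (\<lambda>_ _ f. f)\<rparr>"

definition sub_pull :: "'w psh \<Rightarrow> ('w, 'z) pmap \<Rightarrow> ('z contract, unit, 'w contract, unit) fctr" where
  "sub_pull W h = \<lparr>fob = (\<lambda>C. \<lambda>l \<in> Ob Int_cat. {w \<in> sect W l. h l w \<in> C l}), fmap = (\<lambda>_ _ u. u)\<rparr>"

definition sub_image :: "('w, 'z) pmap \<Rightarrow> ('w contract, unit, 'z contract, unit) fctr" where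
  "sub_image g = \<lparr>fob = (\<lambda>C. \<lambda>l \<in> Ob Int_cat. g l ` C l), fmap = (\<lambda>_ _ u. u)\<rparr>"

text \<open>The sections of all port sheaves are drawn from one type \<open>'a\<close>, which plays the role of a
  universe. A typed function preserves types up to equality of \<open>psh\<close> records, including values of
  \<open>restr\<close> at arguments that denote no morphism of \<open>Int_cat\<close>; this loses nothing, since any family of
  sheaves can be given representatives that agree there.\<close>

record ('i, 'a) tset =
  ports :: "'i set"
  ptype :: "'i \<Rightarrow> 'a psh"

definition typed_finite_set :: "('i, 'a) tset \<Rightarrow> bool" where
  "typed_finite_set X \<longleftrightarrow> finite (ports X) \<and> (\<forall>i \<in> ports X. int_sheaf (ptype X i))"

definition typed_fun :: "('i, 'a) tset \<Rightarrow> ('j, 'a) tset \<Rightarrow> ('i \<Rightarrow> 'j) \<Rightarrow> bool" where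
  "typed_fun X Y f \<longleftrightarrow> f \<in> ports X \<rightarrow>\<^sub>E ports Y \<and> (\<forall>i \<in> ports X. ptype Y (f i) = ptype X i)"

definition empty_tset :: "('i, 'a) tset" where
  "empty_tset = \<lparr>ports = {}, ptype = undefined\<rparr>"

definition sum_tset :: "('i, 'a) tset \<Rightarrow> ('j, 'a) tset \<Rightarrow> ('i + 'j, 'a) tset" (infixr "+\<^sub>T" 65) where
  "X +\<^sub>T Y = \<lparr>ports = ports X <+> ports Y, ptype = case_sum (ptype X) (ptype Y)\<rparr>"

definition hat :: "('i, 'a) tset \<Rightarrow> ('i \<Rightarrow> 'a) psh" where
  "hat X = \<lparr>sect = (\<lambda>l. \<Pi>\<^sub>E i \<in> ports X. sect (ptype X i) l),
     restr = (\<lambda>l' l p w. \<lambda>i \<in> ports X. restr (ptype X i) l' l p (w i))\<rparr>"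

definition hat_map :: "('i, 'a) tset \<Rightarrow> ('j, 'a) tset \<Rightarrow> ('i \<Rightarrow> 'j) \<Rightarrow> ('j \<Rightarrow> 'a, 'i \<Rightarrow> 'a) pmap" where
  "hat_map X Y f = (\<lambda>l \<in> Ob Int_cat. \<lambda>w \<in> sect (hat Y) l. \<lambda>i \<in> ports X. w (f i))"

text \<open>The canonical isomorphism \<open>hat X \<times> hat Y \<cong> hat (X + Y)\<close>.\<close>

definition hat_sum :: "('i, 'a) tset \<Rightarrow> ('j, 'a) tset
    \<Rightarrow> (('i \<Rightarrow> 'a) \<times> ('j \<Rightarrow> 'a), 'i + 'j \<Rightarrow> 'a) pmap" where
  "hat_sum X Y = (\<lambda>l \<in> Ob Int_cat. \<lambda>(v, w) \<in> sect (hat X \<times>\<^sub>P hat Y) l.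
     \<lambda>k \<in> ports (X +\<^sub>T Y). case_sum v w k)"

record ('i, 'a) box =
  inp :: "('i, 'a) tset"
  outp :: "('i, 'a) tset"

definition is_box :: "('i, 'a) box \<Rightarrow> bool" where
  "is_box X \<longleftrightarrow> typed_finite_set (inp X) \<and> typed_finite_set (outp X)"

definition empty_box :: "('i, 'a) box" where
  "empty_box = \<lparr>inp = empty_tset, outp = empty_tset\<rparr>"

definition sum_box :: "('i, 'a) box \<Rightarrow> ('j, 'a) box \<Rightarrow> ('i + 'j, 'a) box" (infixr "\<oplus>\<^sub>B" 65) where
  "X \<oplus>\<^sub>B Y = \<lparr>inp = inp X +\<^sub>T inp Y, outp = outp X +\<^sub>T outp Y\<rparr>"

record ('i, 'j) wiring =
  w_in :: "'i \<Rightarrow> 'i + 'j"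
  w_out :: "'j \<Rightarrow> 'i"

definition wiring_diagram :: "('i, 'a) box \<Rightarrow> ('j, 'a) box \<Rightarrow> ('i, 'j) wiring \<Rightarrow> bool" where
  "wiring_diagram X Y \<phi> \<longleftrightarrow>
     typed_fun (inp X) (outp X +\<^sub>T inp Y) (w_in \<phi>) \<and> typed_fun (outp Y) (outp X) (w_out \<phi>)"

abbreviation Mch_box :: "('i, 'a) box
    \<Rightarrow> (('s, ('i \<Rightarrow> 'a) \<times> ('i \<Rightarrow> 'a)) over, ('s, 's) pmap) cat" where
  "Mch_box X \<equiv> Mch (hat (inp X)) (hat (outp X))"

abbreviation Cntr_box :: "('i, 'a) box \<Rightarrow> ((('i \<Rightarrow> 'a) \<times> ('i \<Rightarrow> 'a)) contract, unit) cat" where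
  "Cntr_box X \<equiv> Cntr (hat (inp X)) (hat (outp X))"

abbreviation CM_box :: "('i, 'a) box
    \<Rightarrow> (('s, ('i \<Rightarrow> 'a) \<times> ('i \<Rightarrow> 'a)) over \<times> (('i \<Rightarrow> 'a) \<times> ('i \<Rightarrow> 'a)) contract,
        ('s, 's) pmap \<times> unit) cat" where
  "CM_box X \<equiv> CM (hat (inp X)) (hat (outp X))"

abbreviation mid :: "('i, 'a) box \<Rightarrow> ('j, 'a) box \<Rightarrow> (('j \<Rightarrow> 'a) \<times> ('i \<Rightarrow> 'a)) psh" where
  "mid X Y \<equiv> hat (inp Y) \<times>\<^sub>P hat (outp X)"

text \<open>\<open>(hat \<phi>\<^sup>i\<^sup>n, \<pi>\<^sub>2)\<close> and \<open>1 \<times> hat \<phi>\<^sup>o\<^sup>u\<^sup>t\<close>.\<close>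

definition wire_in :: "('i, 'a) box \<Rightarrow> ('j, 'a) box \<Rightarrow> ('i, 'j) wiring
    \<Rightarrow> (('j \<Rightarrow> 'a) \<times> ('i \<Rightarrow> 'a), ('i \<Rightarrow> 'a) \<times> ('i \<Rightarrow> 'a)) pmap" where
  "wire_in X Y \<phi> = (\<lambda>l \<in> Ob Int_cat. \<lambda>(y, x) \<in> sect (mid X Y) l.
     (hat_map (inp X) (outp X +\<^sub>T inp Y) (w_in \<phi>) l (hat_sum (outp X) (inp Y) l (x, y)), x))"

definition wire_out :: "('i, 'a) box \<Rightarrow> ('j, 'a) box \<Rightarrow> ('i, 'j) wiring
    \<Rightarrow> (('j \<Rightarrow> 'a) \<times> ('i \<Rightarrow> 'a), ('j \<Rightarrow> 'a) \<times> ('j \<Rightarrow> 'a)) pmap" where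
  "wire_out X Y \<phi> = prod_map (hat (inp Y)) (hat (outp X))
     (id_map (hat (inp Y))) (hat_map (outp Y) (outp X) (w_out \<phi>))"

text \<open>The carrier type of a machine grows under \<open>Mch_wire\<close>, from \<open>'s\<close> to \<open>'s \<times> _\<close>, since the
  pullback is a subset of a product.\<close>

definition Mch_wire :: "('i, 'a) box \<Rightarrow> ('j, 'a) box \<Rightarrow> ('i, 'j) wiring
    \<Rightarrow> (('s, ('i \<Rightarrow> 'a) \<times> ('i \<Rightarrow> 'a)) over, ('s, 's) pmap,
        ('s \<times> ('j \<Rightarrow> 'a) \<times> ('i \<Rightarrow> 'a), ('j \<Rightarrow> 'a) \<times> ('j \<Rightarrow> 'a)) over,
        ('s \<times> ('j \<Rightarrow> 'a) \<times> ('i \<Rightarrow> 'a), 's \<times> ('j \<Rightarrow> 'a) \<times> ('i \<Rightarrow> 'a)) pmap) fctr" where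
  "Mch_wire X Y \<phi> = fcomp (slice_post (wire_out X Y \<phi>)) (slice_pull (mid X Y) (wire_in X Y \<phi>))"

definition Cntr_wire :: "('i, 'a) box \<Rightarrow> ('j, 'a) box \<Rightarrow> ('i, 'j) wiring
    \<Rightarrow> ((('i \<Rightarrow> 'a) \<times> ('i \<Rightarrow> 'a)) contract, unit, (('j \<Rightarrow> 'a) \<times> ('j \<Rightarrow> 'a)) contract, unit) fctr" where
  "Cntr_wire X Y \<phi> = fcomp (sub_image (wire_out X Y \<phi>)) (sub_pull (mid X Y) (wire_in X Y \<phi>))"

text \<open>The isomorphism \<open>(A\<^sub>1 \<times> B\<^sub>1) \<times> (A\<^sub>2 \<times> B\<^sub>2) \<cong> hat (X\<^sub>1 \<oplus> X\<^sub>2)\<^sup>i\<^sup>n \<times> hat (X\<^sub>1 \<oplus> X\<^sub>2)\<^sup>o\<^sup>u\<^sup>t\<close>, where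
  \<open>A\<^sub>k\<close> and \<open>B\<^sub>k\<close> are the products of the input and output types of \<open>X\<^sub>k\<close>.\<close>

definition box_sum :: "('i, 'a) box \<Rightarrow> ('j, 'a) box
    \<Rightarrow> ((('i \<Rightarrow> 'a) \<times> ('i \<Rightarrow> 'a)) \<times> ('j \<Rightarrow> 'a) \<times> ('j \<Rightarrow> 'a), ('i + 'j \<Rightarrow> 'a) \<times> ('i + 'j \<Rightarrow> 'a)) pmap" where
  "box_sum X\<^sub>1 X\<^sub>2 = (\<lambda>l \<in> Ob Int_cat.
     \<lambda>((a\<^sub>1, b\<^sub>1), (a\<^sub>2, b\<^sub>2)) \<in> sect ((hat (inp X\<^sub>1) \<times>\<^sub>P hat (outp X\<^sub>1)) \<times>\<^sub>P hat (inp X\<^sub>2) \<times>\<^sub>P hat (outp X\<^sub>2)) l.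
       (hat_sum (inp X\<^sub>1) (inp X\<^sub>2) l (a\<^sub>1, a\<^sub>2), hat_sum (outp X\<^sub>1) (outp X\<^sub>2) l (b\<^sub>1, b\<^sub>2)))"

definition Mch_lax :: "('i, 'a) box \<Rightarrow> ('j, 'a) box
    \<Rightarrow> (('s, ('i \<Rightarrow> 'a) \<times> ('i \<Rightarrow> 'a)) over \<times> ('t, ('j \<Rightarrow> 'a) \<times> ('j \<Rightarrow> 'a)) over,
        ('s, 's) pmap \<times> ('t, 't) pmap,
        ('s \<times> 't, ('i + 'j \<Rightarrow> 'a) \<times> ('i + 'j \<Rightarrow> 'a)) over, ('s \<times> 't, 's \<times> 't) pmap) fctr" where
  "Mch_lax X\<^sub>1 X\<^sub>2 = \<lparr>
     fob = (\<lambda>((S, p), (T, q)). (S \<times>\<^sub>P T, comp_map (S \<times>\<^sub>P T) (box_sum X\<^sub>1 X\<^sub>2) (prod_map S T p q))),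
     fmap = (\<lambda>((S, p), (T, q)) _ (f, g). prod_map S T f g)\<rparr>"

definition Cntr_lax :: "('i, 'a) box \<Rightarrow> ('j, 'a) box
    \<Rightarrow> ((('i \<Rightarrow> 'a) \<times> ('i \<Rightarrow> 'a)) contract \<times> (('j \<Rightarrow> 'a) \<times> ('j \<Rightarrow> 'a)) contract, unit \<times> unit,
        (('i + 'j \<Rightarrow> 'a) \<times> ('i + 'j \<Rightarrow> 'a)) contract, unit) fctr" where
  "Cntr_lax X\<^sub>1 X\<^sub>2 = \<lparr>
     fob = (\<lambda>(C, D). \<lambda>l \<in> Ob Int_cat. box_sum X\<^sub>1 X\<^sub>2 l ` (C l \<times> D l)),
     fmap = (\<lambda>_ _ _. ())\<rparr>"

text \<open>The units pick out the terminal sheaf, respectively the full sub-presheaf, over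
  \<open>hat \<emptyset> \<times> hat \<emptyset> \<cong> 1\<close>.\<close>

definition Mch_unit :: "(unit, unit, (unit, ('i \<Rightarrow> 'a) \<times> ('i \<Rightarrow> 'a)) over, (unit, unit) pmap) fctr" where
  "Mch_unit = \<lparr>
     fob = (\<lambda>_. (one_psh, \<lambda>l \<in> Ob Int_cat. \<lambda>_ \<in> sect one_psh l. (\<lambda>i \<in> {}. undefined, \<lambda>i \<in> {}. undefined))),
     fmap = (\<lambda>_ _ _. id_map one_psh)\<rparr>"

definition Cntr_unit :: "(unit, unit, (('i \<Rightarrow> 'a) \<times> ('i \<Rightarrow> 'a)) contract, unit) fctr" where
  "Cntr_unit = \<lparr>
     fob = (\<lambda>_. \<lambda>l \<in> Ob Int_cat. sect (hat (inp empty_box) \<times>\<^sub>P hat (outp empty_box)) l),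
     fmap = (\<lambda>_ _ _. ())\<rparr>"

type_synonym ('i, 'a, 's) mc_ob =
  "('s, ('i \<Rightarrow> 'a) \<times> ('i \<Rightarrow> 'a)) over \<times> (('i \<Rightarrow> 'a) \<times> ('i \<Rightarrow> 'a)) contract"
type_synonym 's mc_hom = "('s, 's) pmap \<times> unit"

definition MC_wire :: "('i, 'a) box \<Rightarrow> ('j, 'a) box \<Rightarrow> ('i, 'j) wiring
    \<Rightarrow> (('i, 'a, 's) mc_ob, 's mc_hom,
        ('j, 'a, 's \<times> ('j \<Rightarrow> 'a) \<times> ('i \<Rightarrow> 'a)) mc_ob, ('s \<times> ('j \<Rightarrow> 'a) \<times> ('i \<Rightarrow> 'a)) mc_hom) fctr" where
  "MC_wire X Y \<phi> = Mch_wire X Y \<phi> \<times>\<^sub>F Cntr_wire X Y \<phi>"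

definition MC_lax :: "('i, 'a) box \<Rightarrow> ('j, 'a) box
    \<Rightarrow> (('i, 'a, 's) mc_ob \<times> ('j, 'a, 't) mc_ob, 's mc_hom \<times> 't mc_hom,
        ('i + 'j, 'a, 's \<times> 't) mc_ob, ('s \<times> 't) mc_hom) fctr" where
  "MC_lax X\<^sub>1 X\<^sub>2 = fcomp (Mch_lax X\<^sub>1 X\<^sub>2 \<times>\<^sub>F Cntr_lax X\<^sub>1 X\<^sub>2) interchange"

definition MC_unit :: "(unit, unit, ('i, 'a, unit) mc_ob, unit mc_hom) fctr" where
  "MC_unit = pair_fctr Mch_unit Cntr_unit"

text \<open>To be used with \<open>C'\<close> and \<open>D'\<close> full subcategories of \<open>C\<close> and \<open>D\<close>: they have the same \<open>Hom\<close>,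
  \<open>Idn\<close> and \<open>Cmp\<close>, so \<open>F\<close> itself serves as its restriction.\<close>

definition restricts :: "('o, 'm) cat \<Rightarrow> ('o, 'm) cat \<Rightarrow> ('p, 'n) cat \<Rightarrow> ('p, 'n) cat
    \<Rightarrow> ('o, 'm, 'p, 'n) fctr \<Rightarrow> bool" where
  "restricts C C' D D' F \<longleftrightarrow> is_functor C D F \<and> is_functor C' D' F"

end

theory Submission
  imports Defs
begin

text \<open>A machine \<open>p : S \<rightarrow> A \<times> B\<close> validates a contract \<open>C\<close> exactly when every value of \<open>p\<close> lies in \<open>C\<close>
  (\<open>validates_iff\<close>): a map factors through a sub-presheaf as soon as its values do, since naturality is
  inherited. With this pointwise form the preservation of contracted machines is immediate. For a
  wiring diagram, write \<open>h\<close> for the map along which machines and contracts are pulled back and \<open>g\<close> for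
  the map they are pushed forward along. A section of the wired machine is a pair \<open>(s, w)\<close> with
  \<open>p s = h w\<close>, and its value is \<open>g w\<close>. If \<open>p s\<close> lies in \<open>C\<close>, then \<open>w\<close> lies in the inverse image of \<open>C\<close>
  under \<open>h\<close>, so \<open>g w\<close> lies in the image of that inverse image, which is the wired contract
  (\<open>validates_wire\<close>). For two machines side by side, the pair of values lies in the product of the
  contracts, and both are transported along the same isomorphism (\<open>validates_lax\<close>). The unit contract
  is the full one, which every machine validates.

  Since the subcategories are full, this settles the restriction once the operations are functors
  on the ambient categories (\<open>restricts_full_subcat\<close>), and most of the work is in that. Each operation is
  a composite of general ones: base change and postcomposition between slices, the external product
  of two slices, and inverse and direct images of sub-presheaves. The sheaf condition enters
  in showing that the carriers produced are again interval sheaves, that is, that products and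
  pullbacks of interval sheaves can be glued. For a pullback this uses that sections of the base
  are determined by their restrictions to the two halves of an interval (\<open>int_sheaf_separated\<close>).\<close>

section \<open>Functors between products and full subcategories\<close>

lemma is_functorI:
  assumes "category C" and "category D"
    and "\<And>a. a \<in> Ob C \<Longrightarrow> fob F a \<in> Ob D"
    and "\<And>a b f. \<lbrakk>a \<in> Ob C; b \<in> Ob C; f \<in> Hom C a b\<rbrakk> \<Longrightarrow> fmap F a b f \<in> Hom D (fob F a) (fob F b)"
    and "\<And>a. a \<in> Ob C \<Longrightarrow> fmap F a a (Idn C a) = Idn D (fob F a)"
    and "\<And>a b c f g. \<lbrakk>a \<in> Ob C; b \<in> Ob C; c \<in> Ob C; f \<in> Hom C a b; g \<in> Hom C b c\<rbrakk>
          \<Longrightarrow> fmap F a c (Cmp C a b c g f)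
            = Cmp D (fob F a) (fob F b) (fob F c) (fmap F b c g) (fmap F a b f)"
  shows "is_functor C D F"
  using assms by (simp add: is_functor_def is_functor_axioms_def)

lemma category_prod: "category C \<Longrightarrow> category D \<Longrightarrow> category (C \<times>\<^sub>C D)"
  by (auto simp: category_def prod_cat_def)

lemma category_full_subcat: "category C \<Longrightarrow> category (full_subcat C P)"
  by (simp add: category_def full_subcat_def)

lemma category_one: "category one_cat"
  by (simp add: category_def one_cat_def)

lemma is_functor_fcomp:
  assumes F: "is_functor C D F" and G: "is_functor D E G"
  shows "is_functor C E (fcomp G F)"
  using assms by (simp add: is_functor_def is_functor_axioms_def fcomp_def)

lemma is_functor_prod:
  assumes F: "is_functor C D F" and G: "is_functor C' D' G"
  shows "is_functor (C \<times>\<^sub>C C') (D \<times>\<^sub>C D') (F \<times>\<^sub>F G)"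
proof -
  interpret F: is_functor C D F by (rule F)
  interpret G: is_functor C' D' G by (rule G)
  show ?thesis
    by (rule is_functorI)
      (auto simp: prod_cat_def prod_fctr_def F.fob_closed G.fob_closed F.fmap_closed G.fmap_closed
        F.fmap_Idn G.fmap_Idn F.fmap_Cmp G.fmap_Cmp F.src.category_axioms G.src.category_axioms
        F.tgt.category_axioms G.tgt.category_axioms category_prod[unfolded prod_cat_def])
qed

lemma is_functor_pair:
  assumes F: "is_functor C D F" and G: "is_functor C D' G"
  shows "is_functor C (D \<times>\<^sub>C D') (pair_fctr F G)"
proof -
  interpret F: is_functor C D F by (rule F)
  interpret G: is_functor C D' G by (rule G)
  show ?thesis
    by (rule is_functorI)
      (auto simp: prod_cat_def pair_fctr_def F.fob_closed G.fob_closed F.fmap_closed G.fmap_closed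
        F.fmap_Idn G.fmap_Idn F.fmap_Cmp G.fmap_Cmp F.src.category_axioms
        F.tgt.category_axioms G.tgt.category_axioms category_prod[unfolded prod_cat_def])
qed

lemma is_functor_interchange:
  assumes "category C" "category D" "category C'" "category D'"
  shows "is_functor ((C \<times>\<^sub>C D) \<times>\<^sub>C (C' \<times>\<^sub>C D')) ((C \<times>\<^sub>C C') \<times>\<^sub>C (D \<times>\<^sub>C D')) interchange"
proof (rule is_functorI)
  show "category ((C \<times>\<^sub>C D) \<times>\<^sub>C (C' \<times>\<^sub>C D'))" "category ((C \<times>\<^sub>C C') \<times>\<^sub>C (D \<times>\<^sub>C D'))"
    using assms by (simp_all add: category_prod)
qed (auto simp: prod_cat_def interchange_def)

text \<open>A full subcategory inherits every equation between morphisms, so only the objects have to be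
  checked.\<close>

lemma restricts_full_subcat:
  assumes F: "is_functor C D F" and obj: "\<And>a. a \<in> Ob C \<Longrightarrow> P a \<Longrightarrow> Q (fob F a)"
  shows "restricts C (full_subcat C P) D (full_subcat D Q) F"
proof -
  interpret F: is_functor C D F by (rule F)
  have "is_functor (full_subcat C P) (full_subcat D Q) F"
    by (rule is_functorI)
      (use obj in \<open>simp_all add: category_full_subcat[unfolded full_subcat_def] full_subcat_def
        F.fob_closed F.fmap_closed F.fmap_Idn F.fmap_Cmp F.src.category_axioms F.tgt.category_axioms\<close>)
  with F show ?thesis by (simp add: restricts_def)
qed

lemma prod_full_subcat:
  "full_subcat C P \<times>\<^sub>C full_subcat D Q = full_subcat (C \<times>\<^sub>C D) (\<lambda>(a, b). P a \<and> Q b)"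
  by (auto simp: full_subcat_def prod_cat_def)

lemma full_subcat_True: "full_subcat C (\<lambda>_. True) = C"
  by (simp add: full_subcat_def)


section \<open>Presheaves, interval sheaves and their maps\<close>

lemma Int_cat_simps [simp]:
  "l \<in> Ob Int_cat \<longleftrightarrow> 0 \<le> l"
  "p \<in> Hom Int_cat l' l \<longleftrightarrow> 0 \<le> p \<and> p \<le> l - l'"
  "Idn Int_cat l = 0"
  "Cmp Int_cat l'' l' l p p' = p + p'"
  by (simp_all add: Int_cat_def)

lemma presheafI:
  assumes "\<And>l' l p x. \<lbrakk>0 \<le> l'; 0 \<le> p; p \<le> l - l'; x \<in> sect X l\<rbrakk> \<Longrightarrow> restr X l' l p x \<in> sect X l'"
    and "\<And>l x. \<lbrakk>0 \<le> l; x \<in> sect X l\<rbrakk> \<Longrightarrow> restr X l l 0 x = x"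
    and "\<And>l'' l' l p' p x. \<lbrakk>0 \<le> l''; 0 \<le> p'; p' \<le> l' - l''; 0 \<le> p; p \<le> l - l'; x \<in> sect X l\<rbrakk>
          \<Longrightarrow> restr X l'' l (p + p') x = restr X l'' l' p' (restr X l' l p x)"
  shows "presheaf X"
  using assms by (simp add: presheaf_def)

lemma restr_closed:
  "\<lbrakk>presheaf X; 0 \<le> l'; 0 \<le> p; p \<le> l - l'; x \<in> sect X l\<rbrakk> \<Longrightarrow> restr X l' l p x \<in> sect X l'"
  by (auto simp: presheaf_def Pi_iff)

lemma restr_id: "\<lbrakk>presheaf X; 0 \<le> l; x \<in> sect X l\<rbrakk> \<Longrightarrow> restr X l l 0 x = x"
  by (simp add: presheaf_def)

lemma restr_restr:
  assumes "presheaf X" "0 \<le> l''" "0 \<le> p'" "p' \<le> l' - l''" "0 \<le> p" "p \<le> l - l'" "x \<in> sect X l"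
  shows "restr X l'' l' p' (restr X l' l p x) = restr X l'' l (p + p') x"
  using assms(1)[unfolded presheaf_def, THEN conjunct2, THEN conjunct2, rule_format, of l'' l' l p' p x]
    assms(2-) by simp

lemma int_sheaf_presheaf: "int_sheaf X \<Longrightarrow> presheaf X"
  by (simp add: int_sheaf_def)

lemma int_sheaf_glue:
  assumes "int_sheaf X" "0 \<le> l\<^sub>1" "0 \<le> l\<^sub>2" "x\<^sub>1 \<in> sect X l\<^sub>1" "x\<^sub>2 \<in> sect X l\<^sub>2"
    and "restr X 0 l\<^sub>1 l\<^sub>1 x\<^sub>1 = restr X 0 l\<^sub>2 0 x\<^sub>2"
  obtains x where "x \<in> sect X (l\<^sub>1 + l\<^sub>2)" "restr X l\<^sub>1 (l\<^sub>1 + l\<^sub>2) 0 x = x\<^sub>1" "restr X l\<^sub>2 (l\<^sub>1 + l\<^sub>2) l\<^sub>1 x = x\<^sub>2"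
proof -
  have "\<exists>!x. x \<in> sect X (l\<^sub>1 + l\<^sub>2) \<and> restr X l\<^sub>1 (l\<^sub>1 + l\<^sub>2) 0 x = x\<^sub>1 \<and> restr X l\<^sub>2 (l\<^sub>1 + l\<^sub>2) l\<^sub>1 x = x\<^sub>2"
    using assms by (simp add: int_sheaf_def)
  then show ?thesis using that by blast
qed

text \<open>The two halves of a section always agree at their common end point, so the uniqueness part of
  the sheaf condition applies to any two sections with the same halves.\<close>

lemma int_sheaf_separated:
  assumes X: "int_sheaf X" and l: "0 \<le> l\<^sub>1" "0 \<le> l\<^sub>2"
    and x: "x \<in> sect X (l\<^sub>1 + l\<^sub>2)" and y: "y \<in> sect X (l\<^sub>1 + l\<^sub>2)"
    and eq: "restr X l\<^sub>1 (l\<^sub>1 + l\<^sub>2) 0 x = restr X l\<^sub>1 (l\<^sub>1 + l\<^sub>2) 0 y"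
      "restr X l\<^sub>2 (l\<^sub>1 + l\<^sub>2) l\<^sub>1 x = restr X l\<^sub>2 (l\<^sub>1 + l\<^sub>2) l\<^sub>1 y"
  shows "x = y"
proof -
  note P = int_sheaf_presheaf[OF X]
  let ?x\<^sub>1 = "restr X l\<^sub>1 (l\<^sub>1 + l\<^sub>2) 0 x" and ?x\<^sub>2 = "restr X l\<^sub>2 (l\<^sub>1 + l\<^sub>2) l\<^sub>1 x"
  have in1: "?x\<^sub>1 \<in> sect X l\<^sub>1" and in2: "?x\<^sub>2 \<in> sect X l\<^sub>2"
    using l x by (auto intro!: restr_closed[OF P])
  have "restr X 0 l\<^sub>1 l\<^sub>1 ?x\<^sub>1 = restr X 0 l\<^sub>2 0 ?x\<^sub>2"
    using l x by (simp add: restr_restr[OF P])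
  then have "\<exists>!z. z \<in> sect X (l\<^sub>1 + l\<^sub>2) \<and> restr X l\<^sub>1 (l\<^sub>1 + l\<^sub>2) 0 z = ?x\<^sub>1 \<and> restr X l\<^sub>2 (l\<^sub>1 + l\<^sub>2) l\<^sub>1 z = ?x\<^sub>2"
    using X l in1 in2 by (simp add: int_sheaf_def)
  with x y eq show ?thesis by (metis (no_types))
qed

lemma int_sheafI:
  assumes "presheaf X"
    and "\<And>l\<^sub>1 l\<^sub>2 x\<^sub>1 x\<^sub>2. \<lbrakk>0 \<le> l\<^sub>1; 0 \<le> l\<^sub>2; x\<^sub>1 \<in> sect X l\<^sub>1; x\<^sub>2 \<in> sect X l\<^sub>2;
            restr X 0 l\<^sub>1 l\<^sub>1 x\<^sub>1 = restr X 0 l\<^sub>2 0 x\<^sub>2\<rbrakk>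
          \<Longrightarrow> \<exists>x. x \<in> sect X (l\<^sub>1 + l\<^sub>2) \<and> restr X l\<^sub>1 (l\<^sub>1 + l\<^sub>2) 0 x = x\<^sub>1 \<and> restr X l\<^sub>2 (l\<^sub>1 + l\<^sub>2) l\<^sub>1 x = x\<^sub>2"
    and "\<And>l\<^sub>1 l\<^sub>2 x y. \<lbrakk>0 \<le> l\<^sub>1; 0 \<le> l\<^sub>2; x \<in> sect X (l\<^sub>1 + l\<^sub>2); y \<in> sect X (l\<^sub>1 + l\<^sub>2);
            restr X l\<^sub>1 (l\<^sub>1 + l\<^sub>2) 0 x = restr X l\<^sub>1 (l\<^sub>1 + l\<^sub>2) 0 y;
            restr X l\<^sub>2 (l\<^sub>1 + l\<^sub>2) l\<^sub>1 x = restr X l\<^sub>2 (l\<^sub>1 + l\<^sub>2) l\<^sub>1 y\<rbrakk> \<Longrightarrow> x = y"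
  shows "int_sheaf X"
  unfolding int_sheaf_def Int_cat_simps
proof (intro conjI ballI impI)
  fix l\<^sub>1 l\<^sub>2 x\<^sub>1 x\<^sub>2
  assume "l\<^sub>1 \<in> Ob Int_cat" "l\<^sub>2 \<in> Ob Int_cat" "x\<^sub>1 \<in> sect X l\<^sub>1" "x\<^sub>2 \<in> sect X l\<^sub>2"
    "restr X 0 l\<^sub>1 l\<^sub>1 x\<^sub>1 = restr X 0 l\<^sub>2 0 x\<^sub>2"
  then have l: "0 \<le> l\<^sub>1" "0 \<le> l\<^sub>2"
    and ex: "\<exists>x. x \<in> sect X (l\<^sub>1 + l\<^sub>2) \<and> restr X l\<^sub>1 (l\<^sub>1 + l\<^sub>2) 0 x = x\<^sub>1 \<and> restr X l\<^sub>2 (l\<^sub>1 + l\<^sub>2) l\<^sub>1 x = x\<^sub>2"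
    by (simp_all add: assms(2))
  show "\<exists>!x. x \<in> sect X (l\<^sub>1 + l\<^sub>2) \<and> restr X l\<^sub>1 (l\<^sub>1 + l\<^sub>2) 0 x = x\<^sub>1 \<and> restr X l\<^sub>2 (l\<^sub>1 + l\<^sub>2) l\<^sub>1 x = x\<^sub>2"
    using ex assms(3)[OF l] by (metis (no_types))
qed (rule assms(1))

lemma psh_map_closed: "\<lbrakk>psh_map X Y f; 0 \<le> l; x \<in> sect X l\<rbrakk> \<Longrightarrow> f l x \<in> sect Y l"
  by (auto simp: psh_map_def PiE_iff)

lemma psh_map_natural:
  "\<lbrakk>psh_map X Y f; 0 \<le> l'; 0 \<le> p; p \<le> l - l'; x \<in> sect X l\<rbrakk>
    \<Longrightarrow> f l' (restr X l' l p x) = restr Y l' l p (f l x)"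
  by (simp add: psh_map_def)

lemma psh_map_restrictI:
  assumes "presheaf X"
    and "\<And>l x. \<lbrakk>0 \<le> l; x \<in> sect X l\<rbrakk> \<Longrightarrow> g l x \<in> sect Y l"
    and "\<And>l' l p x. \<lbrakk>0 \<le> l'; 0 \<le> p; p \<le> l - l'; x \<in> sect X l\<rbrakk>
          \<Longrightarrow> g l' (restr X l' l p x) = restr Y l' l p (g l x)"
  shows "psh_map X Y (\<lambda>l \<in> Ob Int_cat. \<lambda>x \<in> sect X l. g l x)"
  using assms by (auto simp: psh_map_def restr_closed)

text \<open>Naturality refers only to restrictions, so a map stays a map when its codomain is exchanged
  for one with the same restrictions that contains all its values.\<close>

lemma psh_map_codomain:
  assumes "psh_map X Y f" and "restr Y' = restr Y"
    and "\<And>l x. \<lbrakk>0 \<le> l; x \<in> sect X l\<rbrakk> \<Longrightarrow> f l x \<in> sect Y' l"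
  shows "psh_map X Y' f"
  using assms by (auto simp: psh_map_def PiE_iff)

lemma id_map_apply [simp]: "\<lbrakk>0 \<le> l; x \<in> sect X l\<rbrakk> \<Longrightarrow> id_map X l x = x"
  by (simp add: id_map_def)

lemma comp_map_apply [simp]: "\<lbrakk>0 \<le> l; x \<in> sect X l\<rbrakk> \<Longrightarrow> comp_map X g f l x = g l (f l x)"
  by (simp add: comp_map_def compose_def)

lemma prod_map_apply [simp]:
  "\<lbrakk>0 \<le> l; x \<in> sect X l; y \<in> sect Y l\<rbrakk> \<Longrightarrow> prod_map X Y f g l (x, y) = (f l x, g l y)"
  by (simp add: prod_map_def prod_psh_def)

lemma comp_map_eqI:
  assumes "psh_map X Z h" and "\<And>l x. \<lbrakk>0 \<le> l; x \<in> sect X l\<rbrakk> \<Longrightarrow> g l (f l x) = h l x"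
  shows "comp_map X g f = h"
proof (intro ext)
  fix l x
  show "comp_map X g f l x = h l x"
    using assms by (cases "0 \<le> l"; cases "x \<in> sect X l")
      (auto simp: psh_map_def comp_map_def compose_def PiE_iff extensional_def)
qed

lemma psh_map_id: "presheaf X \<Longrightarrow> psh_map X X (id_map X)"
  unfolding id_map_def by (rule psh_map_restrictI) auto

lemma psh_map_comp:
  assumes "presheaf X" and f: "psh_map X Y f" and g: "psh_map Y Z g"
  shows "psh_map X Z (comp_map X g f)"
  unfolding comp_map_def compose_def
  by (rule psh_map_restrictI)
    (auto simp: assms(1) psh_map_closed[OF f] psh_map_closed[OF g] psh_map_natural[OF f] psh_map_natural[OF g])

lemma sect_prod [simp]: "sect (X \<times>\<^sub>P Y) l = sect X l \<times> sect Y l"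
  by (simp add: prod_psh_def)

lemma restr_prod [simp]: "restr (X \<times>\<^sub>P Y) l' l p (x, y) = (restr X l' l p x, restr Y l' l p y)"
  by (simp add: prod_psh_def)

lemma presheaf_prod: "presheaf X \<Longrightarrow> presheaf Y \<Longrightarrow> presheaf (X \<times>\<^sub>P Y)"
  by (rule presheafI) (auto simp: restr_closed restr_id restr_restr)

lemma int_sheaf_prod:
  assumes X: "int_sheaf X" and Y: "int_sheaf Y"
  shows "int_sheaf (X \<times>\<^sub>P Y)"
proof (rule int_sheafI)
  show "presheaf (X \<times>\<^sub>P Y)"
    using X Y by (simp add: presheaf_prod int_sheaf_presheaf)
next
  fix l\<^sub>1 l\<^sub>2 z\<^sub>1 z\<^sub>2
  assume l: "0 \<le> l\<^sub>1" "0 \<le> l\<^sub>2" and z: "z\<^sub>1 \<in> sect (X \<times>\<^sub>P Y) l\<^sub>1" "z\<^sub>2 \<in> sect (X \<times>\<^sub>P Y) l\<^sub>2"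
    and eq: "restr (X \<times>\<^sub>P Y) 0 l\<^sub>1 l\<^sub>1 z\<^sub>1 = restr (X \<times>\<^sub>P Y) 0 l\<^sub>2 0 z\<^sub>2"
  obtain x\<^sub>1 y\<^sub>1 x\<^sub>2 y\<^sub>2 where zs: "z\<^sub>1 = (x\<^sub>1, y\<^sub>1)" "z\<^sub>2 = (x\<^sub>2, y\<^sub>2)" by fastforce
  obtain x where "x \<in> sect X (l\<^sub>1 + l\<^sub>2)" "restr X l\<^sub>1 (l\<^sub>1 + l\<^sub>2) 0 x = x\<^sub>1" "restr X l\<^sub>2 (l\<^sub>1 + l\<^sub>2) l\<^sub>1 x = x\<^sub>2"
    using int_sheaf_glue[OF X l, of x\<^sub>1 x\<^sub>2] z eq zs by auto
  moreover obtain y where "y \<in> sect Y (l\<^sub>1 + l\<^sub>2)" "restr Y l\<^sub>1 (l\<^sub>1 + l\<^sub>2) 0 y = y\<^sub>1" "restr Y l\<^sub>2 (l\<^sub>1 + l\<^sub>2) l\<^sub>1 y = y\<^sub>2"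
    using int_sheaf_glue[OF Y l, of y\<^sub>1 y\<^sub>2] z eq zs by auto
  ultimately show "\<exists>z. z \<in> sect (X \<times>\<^sub>P Y) (l\<^sub>1 + l\<^sub>2) \<and> restr (X \<times>\<^sub>P Y) l\<^sub>1 (l\<^sub>1 + l\<^sub>2) 0 z = z\<^sub>1
      \<and> restr (X \<times>\<^sub>P Y) l\<^sub>2 (l\<^sub>1 + l\<^sub>2) l\<^sub>1 z = z\<^sub>2"
    by (intro exI[of _ "(x, y)"]) (simp add: zs)
next
  fix l\<^sub>1 l\<^sub>2 z z'
  assume "0 \<le> l\<^sub>1" "0 \<le> l\<^sub>2" "z \<in> sect (X \<times>\<^sub>P Y) (l\<^sub>1 + l\<^sub>2)" "z' \<in> sect (X \<times>\<^sub>P Y) (l\<^sub>1 + l\<^sub>2)"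
    "restr (X \<times>\<^sub>P Y) l\<^sub>1 (l\<^sub>1 + l\<^sub>2) 0 z = restr (X \<times>\<^sub>P Y) l\<^sub>1 (l\<^sub>1 + l\<^sub>2) 0 z'"
    "restr (X \<times>\<^sub>P Y) l\<^sub>2 (l\<^sub>1 + l\<^sub>2) l\<^sub>1 z = restr (X \<times>\<^sub>P Y) l\<^sub>2 (l\<^sub>1 + l\<^sub>2) l\<^sub>1 z'"
  then show "z = z'"
    using int_sheaf_separated[OF X] int_sheaf_separated[OF Y] by (cases z; cases z') auto
qed

lemma int_sheaf_one: "int_sheaf one_psh"
  by (rule int_sheafI) (auto simp: presheaf_def one_psh_def)

lemma psh_map_prod:
  assumes "presheaf X" "presheaf Y" and f: "psh_map X X' f" and g: "psh_map Y Y' g"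
  shows "psh_map (X \<times>\<^sub>P Y) (X' \<times>\<^sub>P Y') (prod_map X Y f g)"
  unfolding prod_map_def
  by (rule psh_map_restrictI)
    (auto simp: assms(1,2) presheaf_prod psh_map_closed[OF f] psh_map_closed[OF g]
      psh_map_natural[OF f] psh_map_natural[OF g])

lemma sect_pullback [simp]:
  "(s, w) \<in> sect (pullback S W p h) l \<longleftrightarrow> s \<in> sect S l \<and> w \<in> sect W l \<and> p l s = h l w"
  by (simp add: pullback_def)

lemma restr_pullback [simp]:
  "restr (pullback S W p h) l' l q (s, w) = (restr S l' l q s, restr W l' l q w)"
  by (simp add: pullback_def)

text \<open>A glued pair of sections of \<open>S\<close> and \<open>W\<close> lies in the pullback because its two images in \<open>Z\<close> have
  the same halves; here the base \<open>Z\<close> has to be separated.\<close>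

lemma int_sheaf_pullback:
  assumes S: "int_sheaf S" and W: "int_sheaf W" and Z: "int_sheaf Z"
    and p: "psh_map S Z p" and h: "psh_map W Z h"
  shows "int_sheaf (pullback S W p h)"
proof (rule int_sheafI)
  note P = S[THEN int_sheaf_presheaf] W[THEN int_sheaf_presheaf]
  show "presheaf (pullback S W p h)"
    by (rule presheafI)
      (auto simp: restr_closed restr_id restr_restr P psh_map_natural[OF p] psh_map_natural[OF h])
next
  let ?P = "pullback S W p h"
  fix l\<^sub>1 l\<^sub>2 z\<^sub>1 z\<^sub>2
  assume l: "0 \<le> l\<^sub>1" "0 \<le> l\<^sub>2" and z: "z\<^sub>1 \<in> sect ?P l\<^sub>1" "z\<^sub>2 \<in> sect ?P l\<^sub>2"
    and eq: "restr ?P 0 l\<^sub>1 l\<^sub>1 z\<^sub>1 = restr ?P 0 l\<^sub>2 0 z\<^sub>2"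
  obtain s\<^sub>1 w\<^sub>1 s\<^sub>2 w\<^sub>2 where zs: "z\<^sub>1 = (s\<^sub>1, w\<^sub>1)" "z\<^sub>2 = (s\<^sub>2, w\<^sub>2)" by fastforce
  obtain s where s: "s \<in> sect S (l\<^sub>1 + l\<^sub>2)" "restr S l\<^sub>1 (l\<^sub>1 + l\<^sub>2) 0 s = s\<^sub>1" "restr S l\<^sub>2 (l\<^sub>1 + l\<^sub>2) l\<^sub>1 s = s\<^sub>2"
    using int_sheaf_glue[OF S l, of s\<^sub>1 s\<^sub>2] z eq zs by auto
  obtain w where w: "w \<in> sect W (l\<^sub>1 + l\<^sub>2)" "restr W l\<^sub>1 (l\<^sub>1 + l\<^sub>2) 0 w = w\<^sub>1" "restr W l\<^sub>2 (l\<^sub>1 + l\<^sub>2) l\<^sub>1 w = w\<^sub>2"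
    using int_sheaf_glue[OF W l, of w\<^sub>1 w\<^sub>2] z eq zs by auto
  have "p (l\<^sub>1 + l\<^sub>2) s = h (l\<^sub>1 + l\<^sub>2) w"
  proof (rule int_sheaf_separated[OF Z l])
    show "p (l\<^sub>1 + l\<^sub>2) s \<in> sect Z (l\<^sub>1 + l\<^sub>2)" "h (l\<^sub>1 + l\<^sub>2) w \<in> sect Z (l\<^sub>1 + l\<^sub>2)"
      using l s w by (auto intro: psh_map_closed[OF p] psh_map_closed[OF h])
    show "restr Z l\<^sub>1 (l\<^sub>1 + l\<^sub>2) 0 (p (l\<^sub>1 + l\<^sub>2) s) = restr Z l\<^sub>1 (l\<^sub>1 + l\<^sub>2) 0 (h (l\<^sub>1 + l\<^sub>2) w)"
      "restr Z l\<^sub>2 (l\<^sub>1 + l\<^sub>2) l\<^sub>1 (p (l\<^sub>1 + l\<^sub>2) s) = restr Z l\<^sub>2 (l\<^sub>1 + l\<^sub>2) l\<^sub>1 (h (l\<^sub>1 + l\<^sub>2) w)"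
      using l s w z by (simp_all add: zs psh_map_natural[OF p, symmetric] psh_map_natural[OF h, symmetric])
  qed
  then show "\<exists>z. z \<in> sect ?P (l\<^sub>1 + l\<^sub>2) \<and> restr ?P l\<^sub>1 (l\<^sub>1 + l\<^sub>2) 0 z = z\<^sub>1 \<and> restr ?P l\<^sub>2 (l\<^sub>1 + l\<^sub>2) l\<^sub>1 z = z\<^sub>2"
    using s w by (intro exI[of _ "(s, w)"]) (simp add: zs)
next
  let ?P = "pullback S W p h"
  fix l\<^sub>1 l\<^sub>2 z z'
  assume "0 \<le> l\<^sub>1" "0 \<le> l\<^sub>2" "z \<in> sect ?P (l\<^sub>1 + l\<^sub>2)" "z' \<in> sect ?P (l\<^sub>1 + l\<^sub>2)"
    "restr ?P l\<^sub>1 (l\<^sub>1 + l\<^sub>2) 0 z = restr ?P l\<^sub>1 (l\<^sub>1 + l\<^sub>2) 0 z'"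
    "restr ?P l\<^sub>2 (l\<^sub>1 + l\<^sub>2) l\<^sub>1 z = restr ?P l\<^sub>2 (l\<^sub>1 + l\<^sub>2) l\<^sub>1 z'"
  then show "z = z'"
    using int_sheaf_separated[OF S] int_sheaf_separated[OF W] by (cases z; cases z') auto
qed


section \<open>The sheaf of a typed finite set, and the maps induced by wirings\<close>

lemma sect_hat: "sect (hat X) l = (\<Pi>\<^sub>E i \<in> ports X. sect (ptype X i) l)"
  by (simp add: hat_def)

lemma restr_hat: "restr (hat X) l' l p w = (\<lambda>i \<in> ports X. restr (ptype X i) l' l p (w i))"
  by (simp add: hat_def)

lemma int_sheaf_hat:
  assumes "typed_finite_set X"
  shows "int_sheaf (hat X)"
proof (rule int_sheafI)
  have X: "int_sheaf (ptype X i)" if "i \<in> ports X" for i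
    using assms that by (simp add: typed_finite_set_def)
  note P = X[THEN int_sheaf_presheaf]
  show "presheaf (hat X)"
  proof (rule presheafI)
    fix l x assume "0 \<le> l" "x \<in> sect (hat X) l"
    then show "restr (hat X) l l 0 x = x"
      by (intro extensionalityI[of _ "ports X"]) (auto simp: sect_hat restr_hat PiE_iff restr_id[OF P])
  next
    fix l'' l' l p' p x
    assume "0 \<le> l''" "0 \<le> p'" "p' \<le> l' - l''" "0 \<le> p" "p \<le> l - l'" "x \<in> sect (hat X) l"
    then show "restr (hat X) l'' l (p + p') x = restr (hat X) l'' l' p' (restr (hat X) l' l p x)"
      by (auto simp: sect_hat restr_hat PiE_iff restr_restr[OF P] intro!: restrict_ext)
  qed (auto simp: sect_hat restr_hat PiE_iff restr_closed[OF P])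
  fix l\<^sub>1 l\<^sub>2 :: real
  assume l: "0 \<le> l\<^sub>1" "0 \<le> l\<^sub>2"
  {
    fix x\<^sub>1 x\<^sub>2
    assume x: "x\<^sub>1 \<in> sect (hat X) l\<^sub>1" "x\<^sub>2 \<in> sect (hat X) l\<^sub>2"
      and eq: "restr (hat X) 0 l\<^sub>1 l\<^sub>1 x\<^sub>1 = restr (hat X) 0 l\<^sub>2 0 x\<^sub>2"
    have "\<exists>y. y \<in> sect (ptype X i) (l\<^sub>1 + l\<^sub>2) \<and> restr (ptype X i) l\<^sub>1 (l\<^sub>1 + l\<^sub>2) 0 y = x\<^sub>1 i
        \<and> restr (ptype X i) l\<^sub>2 (l\<^sub>1 + l\<^sub>2) l\<^sub>1 y = x\<^sub>2 i" if i: "i \<in> ports X" for i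
    proof -
      have "x\<^sub>1 i \<in> sect (ptype X i) l\<^sub>1" "x\<^sub>2 i \<in> sect (ptype X i) l\<^sub>2"
        using x i by (auto simp: sect_hat)
      moreover have "restr (ptype X i) 0 l\<^sub>1 l\<^sub>1 (x\<^sub>1 i) = restr (ptype X i) 0 l\<^sub>2 0 (x\<^sub>2 i)"
        using fun_cong[OF eq, of i] i by (simp add: restr_hat)
      ultimately show ?thesis
        using int_sheaf_glue[OF X[OF i] l] by metis
    qed
    \<comment> \<open>The sections obtained at the separate ports are collected into one function by choice.\<close>
    then obtain y where y: "\<And>i. i \<in> ports X \<Longrightarrow> y i \<in> sect (ptype X i) (l\<^sub>1 + l\<^sub>2)"
      "\<And>i. i \<in> ports X \<Longrightarrow> restr (ptype X i) l\<^sub>1 (l\<^sub>1 + l\<^sub>2) 0 (y i) = x\<^sub>1 i"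
      "\<And>i. i \<in> ports X \<Longrightarrow> restr (ptype X i) l\<^sub>2 (l\<^sub>1 + l\<^sub>2) l\<^sub>1 (y i) = x\<^sub>2 i"
      by metis
    let ?y = "restrict y (ports X)"
    have "?y \<in> sect (hat X) (l\<^sub>1 + l\<^sub>2)"
      using y by (auto simp: sect_hat)
    moreover have "restr (hat X) l\<^sub>1 (l\<^sub>1 + l\<^sub>2) 0 ?y = x\<^sub>1" "restr (hat X) l\<^sub>2 (l\<^sub>1 + l\<^sub>2) l\<^sub>1 ?y = x\<^sub>2"
      using x y by (auto simp: restr_hat sect_hat PiE_iff intro!: extensionalityI[of _ "ports X"])
    ultimately show "\<exists>x. x \<in> sect (hat X) (l\<^sub>1 + l\<^sub>2) \<and> restr (hat X) l\<^sub>1 (l\<^sub>1 + l\<^sub>2) 0 x = x\<^sub>1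
        \<and> restr (hat X) l\<^sub>2 (l\<^sub>1 + l\<^sub>2) l\<^sub>1 x = x\<^sub>2"
      by blast
  next
    fix x y
    assume x: "x \<in> sect (hat X) (l\<^sub>1 + l\<^sub>2)" and y: "y \<in> sect (hat X) (l\<^sub>1 + l\<^sub>2)"
      and eq: "restr (hat X) l\<^sub>1 (l\<^sub>1 + l\<^sub>2) 0 x = restr (hat X) l\<^sub>1 (l\<^sub>1 + l\<^sub>2) 0 y"
        "restr (hat X) l\<^sub>2 (l\<^sub>1 + l\<^sub>2) l\<^sub>1 x = restr (hat X) l\<^sub>2 (l\<^sub>1 + l\<^sub>2) l\<^sub>1 y"
    show "x = y"
    proof (rule extensionalityI[of _ "ports X"])
      fix i assume i: "i \<in> ports X"
      show "x i = y i"
        using int_sheaf_separated[OF X[OF i] l, of "x i" "y i"] x y i fun_cong[OF eq(1), of i]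
          fun_cong[OF eq(2), of i] by (auto simp: sect_hat restr_hat)
    qed (use x y in \<open>auto simp: sect_hat PiE_iff\<close>)
  }
qed

lemma presheaf_hat: "typed_finite_set X \<Longrightarrow> presheaf (hat X)"
  by (rule int_sheaf_presheaf[OF int_sheaf_hat])

lemma typed_finite_set_sum:
  "typed_finite_set X \<Longrightarrow> typed_finite_set Y \<Longrightarrow> typed_finite_set (X +\<^sub>T Y)"
  by (auto simp: typed_finite_set_def sum_tset_def)

lemma typed_finite_set_empty: "typed_finite_set empty_tset"
  by (simp add: typed_finite_set_def empty_tset_def)

lemma psh_map_hat_map:
  assumes "typed_finite_set Y" and "typed_fun X Y f"
  shows "psh_map (hat Y) (hat X) (hat_map X Y f)"
proof -
  have f: "f i \<in> ports Y" "ptype X i = ptype Y (f i)" if "i \<in> ports X" for i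
    using assms(2) that by (auto simp: typed_fun_def)
  show ?thesis
    unfolding hat_map_def
  proof (rule psh_map_restrictI)
    show "presheaf (hat Y)" by (rule presheaf_hat[OF assms(1)])
  qed (auto simp: sect_hat restr_hat PiE_iff f intro!: restrict_ext)
qed

lemma psh_map_hat_sum:
  assumes "typed_finite_set X" and "typed_finite_set Y"
  shows "psh_map (hat X \<times>\<^sub>P hat Y) (hat (X +\<^sub>T Y)) (hat_sum X Y)"
  unfolding hat_sum_def
proof (rule psh_map_restrictI)
  show "presheaf (hat X \<times>\<^sub>P hat Y)"
    using assms by (simp add: presheaf_prod presheaf_hat)
qed (auto simp: sect_hat restr_hat sum_tset_def intro!: restrict_ext split: sum.splits)

lemma psh_map_wire_in:
  assumes X: "is_box X" and Y: "is_box Y" and \<phi>: "wiring_diagram X Y \<phi>"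
  shows "psh_map (mid X Y) (hat (inp X) \<times>\<^sub>P hat (outp X)) (wire_in X Y \<phi>)"
proof -
  have t: "typed_finite_set (inp X)" "typed_finite_set (outp X)" "typed_finite_set (inp Y)"
    using X Y by (simp_all add: is_box_def)
  have hm: "psh_map (hat (outp X +\<^sub>T inp Y)) (hat (inp X)) (hat_map (inp X) (outp X +\<^sub>T inp Y) (w_in \<phi>))"
    using \<phi> t by (intro psh_map_hat_map typed_finite_set_sum) (simp_all add: wiring_diagram_def)
  note hs = psh_map_hat_sum[OF t(2,3)]
  show ?thesis
    unfolding wire_in_def
  proof (rule psh_map_restrictI)
    show "presheaf (mid X Y)"
      using t by (simp add: presheaf_prod presheaf_hat)
  next
    fix l' l p z
    assume *: "0 \<le> l'" "0 \<le> p" "p \<le> l - l'" and z: "z \<in> sect (mid X Y) l"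
    obtain y x where "z = (y, x)" "y \<in> sect (hat (inp Y)) l" "x \<in> sect (hat (outp X)) l"
      using z by auto
    with * show "(case restr (mid X Y) l' l p z of (y, x) \<Rightarrow>
         (hat_map (inp X) (outp X +\<^sub>T inp Y) (w_in \<phi>) l' (hat_sum (outp X) (inp Y) l' (x, y)), x))
       = restr (hat (inp X) \<times>\<^sub>P hat (outp X)) l' l p (case z of (y, x) \<Rightarrow>
         (hat_map (inp X) (outp X +\<^sub>T inp Y) (w_in \<phi>) l (hat_sum (outp X) (inp Y) l (x, y)), x))"
      using psh_map_natural[OF hs *, of "(x, y)"] psh_map_closed[OF hs, of l "(x, y)"]
      by (simp add: psh_map_natural[OF hm])
  qed (auto intro!: psh_map_closed[OF hm] psh_map_closed[OF hs])
qed

lemma psh_map_wire_out: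
  assumes X: "is_box X" and Y: "is_box Y" and \<phi>: "wiring_diagram X Y \<phi>"
  shows "psh_map (mid X Y) (hat (inp Y) \<times>\<^sub>P hat (outp Y)) (wire_out X Y \<phi>)"
  unfolding wire_out_def using assms
  by (intro psh_map_prod psh_map_id psh_map_hat_map presheaf_hat) (auto simp: is_box_def wiring_diagram_def)

lemma psh_map_box_sum:
  assumes X: "is_box X\<^sub>1" and Y: "is_box X\<^sub>2"
  shows "psh_map ((hat (inp X\<^sub>1) \<times>\<^sub>P hat (outp X\<^sub>1)) \<times>\<^sub>P hat (inp X\<^sub>2) \<times>\<^sub>P hat (outp X\<^sub>2))
    (hat (inp (X\<^sub>1 \<oplus>\<^sub>B X\<^sub>2)) \<times>\<^sub>P hat (outp (X\<^sub>1 \<oplus>\<^sub>B X\<^sub>2))) (box_sum X\<^sub>1 X\<^sub>2)"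
proof -
  have t: "typed_finite_set (inp X\<^sub>1)" "typed_finite_set (outp X\<^sub>1)"
    "typed_finite_set (inp X\<^sub>2)" "typed_finite_set (outp X\<^sub>2)"
    using X Y by (simp_all add: is_box_def)
  note hs = psh_map_hat_sum[OF t(1,3)] psh_map_hat_sum[OF t(2,4)]
  have nat: "hat_sum U V l' (restr (hat U) l' l p u, restr (hat V) l' l p v)
      = restr (hat (U +\<^sub>T V)) l' l p (hat_sum U V l (u, v))"
    if "typed_finite_set U" "typed_finite_set V" "0 \<le> l'" "0 \<le> p" "p \<le> l - l'"
      "u \<in> sect (hat U) l" "v \<in> sect (hat V) l" for U V l' l p u v
    using psh_map_natural[OF psh_map_hat_sum[OF that(1,2)] that(3-5), of "(u, v)"] that by simp
  show ?thesis
    unfolding box_sum_def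
  proof (rule psh_map_restrictI)
    show "presheaf ((hat (inp X\<^sub>1) \<times>\<^sub>P hat (outp X\<^sub>1)) \<times>\<^sub>P hat (inp X\<^sub>2) \<times>\<^sub>P hat (outp X\<^sub>2))"
      using t by (simp add: presheaf_prod presheaf_hat)
  qed (auto simp: sum_box_def nat t intro!: psh_map_closed[OF hs(1)] psh_map_closed[OF hs(2)])
qed


section \<open>Machines\<close>

lemma comp_map_assoc:
  assumes "psh_map X Y f"
  shows "comp_map X (comp_map Y h g) f = comp_map X h (comp_map X g f)"
  using psh_map_closed[OF assms]
  by (auto simp: comp_map_def compose_def fun_eq_iff restrict_def)

lemma category_slice: "category (slice Z)"
proof
  fix a assume "a \<in> Ob (slice Z)"
  then show "Idn (slice Z) a \<in> Hom (slice Z) a a"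
    by (auto simp: slice_def psh_map_id int_sheaf_presheaf intro!: comp_map_eqI)
next
  fix a b c f g
  assume "a \<in> Ob (slice Z)" "b \<in> Ob (slice Z)" "c \<in> Ob (slice Z)"
    "f \<in> Hom (slice Z) a b" "g \<in> Hom (slice Z) b c"
  then show "Cmp (slice Z) a b c g f \<in> Hom (slice Z) a c"
    by (auto simp: slice_def int_sheaf_presheaf psh_map_comp comp_map_assoc[symmetric])
next
  fix a b f
  assume "a \<in> Ob (slice Z)" "b \<in> Ob (slice Z)" "f \<in> Hom (slice Z) a b"
  then show "Cmp (slice Z) a a b f (Idn (slice Z) a) = f" "Cmp (slice Z) a b b (Idn (slice Z) b) f = f"
    by (auto simp: slice_def psh_map_closed intro!: comp_map_eqI)
next
  fix a b c d f g h
  assume "a \<in> Ob (slice Z)" "b \<in> Ob (slice Z)" "c \<in> Ob (slice Z)" "d \<in> Ob (slice Z)"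
    "f \<in> Hom (slice Z) a b" "g \<in> Hom (slice Z) b c" "h \<in> Hom (slice Z) c d"
  then show "Cmp (slice Z) a b d (Cmp (slice Z) b c d h g) f = Cmp (slice Z) a c d h (Cmp (slice Z) a b c g f)"
    by (auto simp: slice_def comp_map_assoc)
qed

lemma slice_Hom_apply:
  "\<lbrakk>comp_map S q f = p; 0 \<le> l; s \<in> sect S l\<rbrakk> \<Longrightarrow> q l (f l s) = p l s"
  using comp_map_apply by metis

lemma is_functor_slice_post:
  assumes "psh_map W Z g"
  shows "is_functor (slice W) (slice Z) (slice_post g)"
proof (rule is_functorI)
  fix a b f
  assume "a \<in> Ob (slice W)" "b \<in> Ob (slice W)" "f \<in> Hom (slice W) a b"
  then show "fmap (slice_post g) a b f \<in> Hom (slice Z) (fob (slice_post g) a) (fob (slice_post g) b)"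
    by (auto simp: slice_def slice_post_def comp_map_assoc)
qed (use assms in \<open>auto simp: category_slice[unfolded slice_def] slice_def slice_post_def psh_map_comp int_sheaf_presheaf\<close>)

text \<open>A map \<open>f\<close> over \<open>Z\<close> leaves \<open>p s\<close> unchanged, so \<open>(f s, w)\<close> satisfies the same equation with \<open>h w\<close> as
  \<open>(s, w)\<close> does; this is the action of base change on morphisms.\<close>

lemma is_functor_slice_pull:
  assumes W: "int_sheaf W" and Z: "int_sheaf Z" and h: "psh_map W Z h"
  shows "is_functor (slice Z) (slice W) (slice_pull W h)"
proof -
  let ?P = "\<lambda>S p. pullback S W p h"
  let ?\<pi> = "\<lambda>S p. \<lambda>l \<in> Ob Int_cat. \<lambda>(s, w) \<in> sect (?P S p) l. w"
  let ?m = "\<lambda>S p f. \<lambda>l \<in> Ob Int_cat. \<lambda>(s, w) \<in> sect (?P S p) l. (f l s, w)"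
  have pb: "int_sheaf (?P S p)" if "int_sheaf S" "psh_map S Z p" for S p
    by (rule int_sheaf_pullback[OF that(1) W Z that(2) h])
  have proj: "psh_map (?P S p) W (?\<pi> S p)" if "int_sheaf S" "psh_map S Z p" for S p
    by (rule psh_map_restrictI) (use pb[OF that] in \<open>auto simp: int_sheaf_presheaf\<close>)
  have map: "psh_map (?P S p) (?P T q) (?m S p f)"
    if "int_sheaf S" "psh_map S Z p" and f: "psh_map S T f" and eq: "comp_map S q f = p" for S p T q f
    by (rule psh_map_restrictI) (use pb[OF that(1,2)] in
      \<open>auto simp: int_sheaf_presheaf psh_map_closed[OF f] psh_map_natural[OF f] slice_Hom_apply[OF eq]\<close>)
  show ?thesis
  proof (rule is_functorI)
    fix a assume "a \<in> Ob (slice Z)"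
    then show "fob (slice_pull W h) a \<in> Ob (slice W)"
      by (auto simp: slice_def slice_pull_def pb proj)
  next
    fix a b f
    assume "a \<in> Ob (slice Z)" "b \<in> Ob (slice Z)" and f: "f \<in> Hom (slice Z) a b"
    then obtain S p T q where ab: "a = (S, p)" "b = (T, q)" "int_sheaf S" "psh_map S Z p"
      and f: "psh_map S T f" and eq: "comp_map S q f = p"
      by (auto simp: slice_def)
    have "comp_map (?P S p) (?\<pi> T q) (?m S p f) = ?\<pi> S p"
      by (rule comp_map_eqI[OF proj[OF ab(3,4)]])
        (auto simp: psh_map_closed[OF f] slice_Hom_apply[OF eq])
    then show "fmap (slice_pull W h) a b f \<in> Hom (slice W) (fob (slice_pull W h) a) (fob (slice_pull W h) b)"
      using map[OF ab(3,4) f eq] by (simp add: ab slice_def slice_pull_def)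
  next
    fix a assume "a \<in> Ob (slice Z)"
    then show "fmap (slice_pull W h) a a (Idn (slice Z) a) = Idn (slice W) (fob (slice_pull W h) a)"
      by (auto simp: slice_def slice_pull_def id_map_def fun_eq_iff restrict_def)
  next
    fix a b c f g
    assume "a \<in> Ob (slice Z)" "b \<in> Ob (slice Z)" "c \<in> Ob (slice Z)"
      "f \<in> Hom (slice Z) a b" "g \<in> Hom (slice Z) b c"
    then obtain S p T q R r where abc: "a = (S, p)" "b = (T, q)" "c = (R, r)"
      "int_sheaf S" "psh_map S Z p" and f: "psh_map S T f" and eq: "comp_map S q f = p"
      and g: "psh_map T R g" and eq': "comp_map T r g = q"
      by (auto simp: slice_def)
    have "comp_map S r (comp_map S g f) = p"
      using eq eq' by (simp add: comp_map_assoc[OF f, symmetric])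
    then have "comp_map (?P S p) (?m T q g) (?m S p f) = ?m S p (comp_map S g f)"
      by (intro comp_map_eqI[OF map[OF abc(4,5) psh_map_comp[OF int_sheaf_presheaf[OF abc(4)] f g]]])
        (auto simp: psh_map_closed[OF f] slice_Hom_apply[OF eq])
    then show "fmap (slice_pull W h) a c (Cmp (slice Z) a b c g f)
        = Cmp (slice W) (fob (slice_pull W h) a) (fob (slice_pull W h) b) (fob (slice_pull W h) c)
            (fmap (slice_pull W h) b c g) (fmap (slice_pull W h) a b f)"
      by (simp add: abc slice_def slice_pull_def)
  qed (rule category_slice)+
qed

text \<open>The lax structure on machines first forms the product over the product of the bases and then
  transports it to the base of the sum box; only the first step is special to it.\<close>

definition slice_prod :: "(('s, 'z) over \<times> ('t, 'w) over, ('s, 's) pmap \<times> ('t, 't) pmap,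
    ('s \<times> 't, 'z \<times> 'w) over, ('s \<times> 't, 's \<times> 't) pmap) fctr" where
  "slice_prod = \<lparr>fob = (\<lambda>((S, p), (T, q)). (S \<times>\<^sub>P T, prod_map S T p q)),
     fmap = (\<lambda>((S, p), (T, q)) _ (f, g). prod_map S T f g)\<rparr>"

lemma is_functor_slice_prod: "is_functor (slice Z \<times>\<^sub>C slice W) (slice (Z \<times>\<^sub>P W)) slice_prod"
proof (rule is_functorI)
  fix a assume "a \<in> Ob (slice Z \<times>\<^sub>C slice W)"
  then show "fob slice_prod a \<in> Ob (slice (Z \<times>\<^sub>P W))"
    by (auto simp: slice_def slice_prod_def prod_cat_def int_sheaf_prod psh_map_prod int_sheaf_presheaf)
  show "fmap slice_prod a a (Idn (slice Z \<times>\<^sub>C slice W) a) = Idn (slice (Z \<times>\<^sub>P W)) (fob slice_prod a)"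
    by (cases a) (auto simp: slice_def slice_prod_def prod_cat_def prod_map_def id_map_def fun_eq_iff restrict_def)
next
  fix a b f
  assume "a \<in> Ob (slice Z \<times>\<^sub>C slice W)" "b \<in> Ob (slice Z \<times>\<^sub>C slice W)" "f \<in> Hom (slice Z \<times>\<^sub>C slice W) a b"
  then obtain S p T q S' p' T' q' f\<^sub>1 f\<^sub>2 where abf: "a = ((S, p), (T, q))" "b = ((S', p'), (T', q'))" "f = (f\<^sub>1, f\<^sub>2)"
    and S: "int_sheaf S" and T: "int_sheaf T" and p: "psh_map S Z p" and q: "psh_map T W q"
    and f: "psh_map S S' f\<^sub>1" "psh_map T T' f\<^sub>2" and eq: "comp_map S p' f\<^sub>1 = p" "comp_map T q' f\<^sub>2 = q"
    by (cases f) (auto simp: slice_def prod_cat_def)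
  note P = S[THEN int_sheaf_presheaf] T[THEN int_sheaf_presheaf]
  have "comp_map (S \<times>\<^sub>P T) (prod_map S' T' p' q') (prod_map S T f\<^sub>1 f\<^sub>2) = prod_map S T p q"
    by (rule comp_map_eqI[OF psh_map_prod[OF P p q]])
      (auto simp: psh_map_closed[OF f(1)] psh_map_closed[OF f(2)] slice_Hom_apply[OF eq(1)] slice_Hom_apply[OF eq(2)])
  then show "fmap slice_prod a b f \<in> Hom (slice (Z \<times>\<^sub>P W)) (fob slice_prod a) (fob slice_prod b)"
    using psh_map_prod[OF P f] by (simp add: slice_def slice_prod_def abf)
next
  fix a b c f g
  assume "a \<in> Ob (slice Z \<times>\<^sub>C slice W)" "b \<in> Ob (slice Z \<times>\<^sub>C slice W)" "c \<in> Ob (slice Z \<times>\<^sub>C slice W)"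
    "f \<in> Hom (slice Z \<times>\<^sub>C slice W) a b" "g \<in> Hom (slice Z \<times>\<^sub>C slice W) b c"
  then obtain S p T q S' p' T' q' S'' p'' T'' q'' f\<^sub>1 f\<^sub>2 g\<^sub>1 g\<^sub>2 where abc: "a = ((S, p), (T, q))"
    "b = ((S', p'), (T', q'))" "c = ((S'', p''), (T'', q''))" "f = (f\<^sub>1, f\<^sub>2)" "g = (g\<^sub>1, g\<^sub>2)"
    and S: "int_sheaf S" and T: "int_sheaf T"
    and f: "psh_map S S' f\<^sub>1" "psh_map T T' f\<^sub>2" and g: "psh_map S' S'' g\<^sub>1" "psh_map T' T'' g\<^sub>2"
    by (cases f; cases g) (auto simp: slice_def prod_cat_def)
  note P = S[THEN int_sheaf_presheaf] T[THEN int_sheaf_presheaf]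
  have "comp_map (S \<times>\<^sub>P T) (prod_map S' T' g\<^sub>1 g\<^sub>2) (prod_map S T f\<^sub>1 f\<^sub>2)
      = prod_map S T (comp_map S g\<^sub>1 f\<^sub>1) (comp_map T g\<^sub>2 f\<^sub>2)"
    by (rule comp_map_eqI[OF psh_map_prod[OF P psh_map_comp[OF P(1) f(1) g(1)] psh_map_comp[OF P(2) f(2) g(2)]]])
      (auto simp: psh_map_closed[OF f(1)] psh_map_closed[OF f(2)])
  then show "fmap slice_prod a c (Cmp (slice Z \<times>\<^sub>C slice W) a b c g f)
      = Cmp (slice (Z \<times>\<^sub>P W)) (fob slice_prod a) (fob slice_prod b) (fob slice_prod c)
          (fmap slice_prod b c g) (fmap slice_prod a b f)"
    by (simp add: slice_def slice_prod_def abc prod_cat_def)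
qed (intro category_slice category_prod)+

lemma int_sheaf_box: "is_box X \<Longrightarrow> int_sheaf (hat (inp X)) \<and> int_sheaf (hat (outp X))"
  by (simp add: is_box_def int_sheaf_hat)

lemma is_functor_Mch_wire:
  assumes "is_box X" and "is_box Y" and "wiring_diagram X Y \<phi>"
  shows "is_functor (Mch_box X) (Mch_box Y) (Mch_wire X Y \<phi>)"
  unfolding Mch_wire_def Mch_def
  by (rule is_functor_fcomp[OF is_functor_slice_pull is_functor_slice_post])
    (use assms in \<open>simp_all add: int_sheaf_prod int_sheaf_box psh_map_wire_in psh_map_wire_out\<close>)

lemma Mch_lax_eq: "Mch_lax X\<^sub>1 X\<^sub>2 = fcomp (slice_post (box_sum X\<^sub>1 X\<^sub>2)) slice_prod"
  by (simp add: Mch_lax_def fcomp_def slice_post_def slice_prod_def fun_eq_iff)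

lemma is_functor_Mch_lax:
  assumes "is_box X\<^sub>1" and "is_box X\<^sub>2"
  shows "is_functor (Mch_box X\<^sub>1 \<times>\<^sub>C Mch_box X\<^sub>2) (Mch_box (X\<^sub>1 \<oplus>\<^sub>B X\<^sub>2)) (Mch_lax X\<^sub>1 X\<^sub>2)"
  unfolding Mch_lax_eq Mch_def
  by (rule is_functor_fcomp[OF is_functor_slice_prod is_functor_slice_post[OF psh_map_box_sum[OF assms]]])

lemma is_functor_Mch_unit: "is_functor one_cat (Mch_box empty_box) Mch_unit"
proof (rule is_functorI)
  let ?p = "\<lambda>l \<in> Ob Int_cat. \<lambda>_ \<in> sect one_psh l. (\<lambda>i \<in> {}. undefined, \<lambda>i \<in> {}. undefined)"
  note P = int_sheaf_presheaf[OF int_sheaf_one]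
  have p: "psh_map one_psh (hat (inp empty_box) \<times>\<^sub>P hat (outp empty_box)) ?p"
    by (rule psh_map_restrictI[OF P]) (auto simp: empty_box_def empty_tset_def sect_hat restr_hat)
  then show "fob Mch_unit a \<in> Ob (Mch_box empty_box)" for a
    by (simp add: Mch_unit_def Mch_def slice_def int_sheaf_one)
  show "fmap Mch_unit a b f \<in> Hom (Mch_box empty_box) (fob Mch_unit a) (fob Mch_unit b)" for a b f
    using comp_map_eqI[OF p, of ?p "id_map one_psh"]
    by (simp add: Mch_unit_def Mch_def slice_def psh_map_id P)
  show "fmap Mch_unit a c (Cmp one_cat a b c g f) = Cmp (Mch_box empty_box) (fob Mch_unit a)
      (fob Mch_unit b) (fob Mch_unit c) (fmap Mch_unit b c g) (fmap Mch_unit a b f)" for a b c f g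
    by (auto simp: Mch_unit_def Mch_def slice_def intro!: comp_map_eqI[OF psh_map_id[OF P], symmetric])
qed (simp_all add: category_one Mch_def category_slice Mch_unit_def, simp add: slice_def)


section \<open>Contracts\<close>

lemma Cntr_simps [simp]:
  "C \<in> Ob (Cntr A B) \<longleftrightarrow> sub_presheaf (A \<times>\<^sub>P B) C"
  "u \<in> Hom (Cntr A B) C D \<longleftrightarrow> (\<forall>l \<ge> 0. C l \<subseteq> D l)"
  by (auto simp: Cntr_def)

lemma category_Cntr: "category (Cntr A B)"
  unfolding category_def Cntr_def by auto

lemma sub_presheafD:
  assumes "sub_presheaf Z C" and "0 \<le> l"
  shows "c \<in> C l \<Longrightarrow> c \<in> sect Z l"
    and "\<lbrakk>c \<in> C l; 0 \<le> l'; 0 \<le> p; p \<le> l - l'\<rbrakk> \<Longrightarrow> restr Z l' l p c \<in> C l'"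
  using assms by (auto simp: sub_presheaf_def PiE_iff image_subset_iff)

lemma sub_presheaf_restrictI:
  assumes "\<And>l. 0 \<le> l \<Longrightarrow> D l \<subseteq> sect Z l"
    and "\<And>l' l p c. \<lbrakk>0 \<le> l'; 0 \<le> p; p \<le> l - l'; c \<in> D l\<rbrakk> \<Longrightarrow> restr Z l' l p c \<in> D l'"
  shows "sub_presheaf Z (\<lambda>l \<in> Ob Int_cat. D l)"
  using assms by (auto simp: sub_presheaf_def)

text \<open>Posets are thin, so a functor into one is a monotone map on objects.\<close>

lemma is_functor_CntrI:
  assumes "category C" and "\<And>a. a \<in> Ob C \<Longrightarrow> sub_presheaf (A \<times>\<^sub>P B) (fob F a)"
    and "\<And>a b f l. \<lbrakk>a \<in> Ob C; b \<in> Ob C; f \<in> Hom C a b; 0 \<le> l\<rbrakk> \<Longrightarrow> fob F a l \<subseteq> fob F b l"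
  shows "is_functor C (Cntr A B) F"
  by (rule is_functorI) (use assms in \<open>auto simp: category_Cntr\<close>)

lemma is_functor_sub_pull:
  assumes W: "presheaf (A' \<times>\<^sub>P B')" and h: "psh_map (A' \<times>\<^sub>P B') (A \<times>\<^sub>P B) h"
  shows "is_functor (Cntr A B) (Cntr A' B') (sub_pull (A' \<times>\<^sub>P B') h)"
proof (rule is_functor_CntrI[OF category_Cntr])
  fix C assume "C \<in> Ob (Cntr A B)"
  then have "sub_presheaf (A \<times>\<^sub>P B) C" by simp
  note D = sub_presheafD[OF this]
  have "sub_presheaf (A' \<times>\<^sub>P B') (\<lambda>l \<in> Ob Int_cat. {w \<in> sect (A' \<times>\<^sub>P B') l. h l w \<in> C l})"
  proof (rule sub_presheaf_restrictI)
    fix l' l p c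
    assume *: "0 \<le> l'" "0 \<le> p" "p \<le> l - l'" and c: "c \<in> {w \<in> sect (A' \<times>\<^sub>P B') l. h l w \<in> C l}"
    then show "restr (A' \<times>\<^sub>P B') l' l p c \<in> {w \<in> sect (A' \<times>\<^sub>P B') l'. h l' w \<in> C l'}"
      using restr_closed[OF W *] psh_map_natural[OF h *] D(2)[OF _ _ *] by auto
  qed blast
  then show "sub_presheaf (A' \<times>\<^sub>P B') (fob (sub_pull (A' \<times>\<^sub>P B') h) C)"
    by (simp add: sub_pull_def)
qed (auto simp: sub_pull_def)

lemma sub_presheaf_image:
  assumes g: "psh_map W Z g" and D: "sub_presheaf W D"
  shows "sub_presheaf Z (\<lambda>l \<in> Ob Int_cat. g l ` D l)"
proof (rule sub_presheaf_restrictI)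
  note D = sub_presheafD[OF D]
  show "g l ` D l \<subseteq> sect Z l" if "0 \<le> l" for l
    using D(1)[OF that] psh_map_closed[OF g that] by auto
  fix l' l p c
  assume *: "0 \<le> l'" "0 \<le> p" "p \<le> l - l'" and "c \<in> g l ` D l"
  then obtain d where d: "d \<in> D l" "c = g l d" by blast
  have "restr Z l' l p c = g l' (restr W l' l p d)"
    using psh_map_natural[OF g *] D(1) d * by simp
  then show "restr Z l' l p c \<in> g l' ` D l'"
    using D(2) d * by simp
qed

lemma is_functor_sub_image:
  assumes g: "psh_map (A \<times>\<^sub>P B) (A' \<times>\<^sub>P B') g"
  shows "is_functor (Cntr A B) (Cntr A' B') (sub_image g)"
proof (rule is_functor_CntrI[OF category_Cntr])
  fix C assume "C \<in> Ob (Cntr A B)"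
  then show "sub_presheaf (A' \<times>\<^sub>P B') (fob (sub_image g) C)"
    using sub_presheaf_image[OF g] by (simp add: sub_image_def)
qed (auto simp: sub_image_def image_mono)

lemma is_functor_Cntr_wire:
  assumes "is_box X" and "is_box Y" and "wiring_diagram X Y \<phi>"
  shows "is_functor (Cntr_box X) (Cntr_box Y) (Cntr_wire X Y \<phi>)"
  unfolding Cntr_wire_def
  by (rule is_functor_fcomp[OF is_functor_sub_pull is_functor_sub_image])
    (use assms in \<open>simp_all add: presheaf_prod int_sheaf_box int_sheaf_presheaf psh_map_wire_in psh_map_wire_out\<close>)

lemma is_functor_Cntr_lax:
  assumes "is_box X\<^sub>1" and "is_box X\<^sub>2"
  shows "is_functor (Cntr_box X\<^sub>1 \<times>\<^sub>C Cntr_box X\<^sub>2) (Cntr_box (X\<^sub>1 \<oplus>\<^sub>B X\<^sub>2)) (Cntr_lax X\<^sub>1 X\<^sub>2)"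
proof (rule is_functor_CntrI)
  show "category (Cntr_box X\<^sub>1 \<times>\<^sub>C Cntr_box X\<^sub>2)" by (intro category_prod category_Cntr)
next
  fix a
  let ?Z\<^sub>1 = "hat (inp X\<^sub>1) \<times>\<^sub>P hat (outp X\<^sub>1)" and ?Z\<^sub>2 = "hat (inp X\<^sub>2) \<times>\<^sub>P hat (outp X\<^sub>2)"
  assume "a \<in> Ob (Cntr_box X\<^sub>1 \<times>\<^sub>C Cntr_box X\<^sub>2)"
  then obtain C D where a: "a = (C, D)" and C: "sub_presheaf ?Z\<^sub>1 C" and D: "sub_presheaf ?Z\<^sub>2 D"
    by (auto simp: prod_cat_def)
  have "sub_presheaf (?Z\<^sub>1 \<times>\<^sub>P ?Z\<^sub>2) (\<lambda>l \<in> Ob Int_cat. C l \<times> D l)"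
  proof (rule sub_presheaf_restrictI)
    show "C l \<times> D l \<subseteq> sect (?Z\<^sub>1 \<times>\<^sub>P ?Z\<^sub>2) l" if "0 \<le> l" for l
      using sub_presheafD(1)[OF C that] sub_presheafD(1)[OF D that] by auto
    show "restr (?Z\<^sub>1 \<times>\<^sub>P ?Z\<^sub>2) l' l p c \<in> C l' \<times> D l'"
      if "0 \<le> l'" "0 \<le> p" "p \<le> l - l'" "c \<in> C l \<times> D l" for l' l p c
      using that sub_presheafD(2)[OF C, of l "fst c" l' p] sub_presheafD(2)[OF D, of l "snd c" l' p]
      by (cases c) auto
  qed
  from sub_presheaf_image[OF psh_map_box_sum[OF assms] this]
  have "sub_presheaf (hat (inp (X\<^sub>1 \<oplus>\<^sub>B X\<^sub>2)) \<times>\<^sub>P hat (outp (X\<^sub>1 \<oplus>\<^sub>B X\<^sub>2)))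
      (\<lambda>l \<in> Ob Int_cat. box_sum X\<^sub>1 X\<^sub>2 l ` (C l \<times> D l))"
    by (simp cong: restrict_cong)
  then show "sub_presheaf (hat (inp (X\<^sub>1 \<oplus>\<^sub>B X\<^sub>2)) \<times>\<^sub>P hat (outp (X\<^sub>1 \<oplus>\<^sub>B X\<^sub>2))) (fob (Cntr_lax X\<^sub>1 X\<^sub>2) a)"
    by (simp add: Cntr_lax_def a)
next
  fix a b f l
  assume "a \<in> Ob (Cntr_box X\<^sub>1 \<times>\<^sub>C Cntr_box X\<^sub>2)" "b \<in> Ob (Cntr_box X\<^sub>1 \<times>\<^sub>C Cntr_box X\<^sub>2)"
    "f \<in> Hom (Cntr_box X\<^sub>1 \<times>\<^sub>C Cntr_box X\<^sub>2) a b" "0 \<le> (l :: real)"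
  then show "fob (Cntr_lax X\<^sub>1 X\<^sub>2) a l \<subseteq> fob (Cntr_lax X\<^sub>1 X\<^sub>2) b l"
    by (cases a; cases b) (auto simp: Cntr_lax_def prod_cat_def mem_Times_iff intro!: image_mono Sigma_mono)
qed

lemma is_functor_Cntr_unit: "is_functor one_cat (Cntr_box empty_box) Cntr_unit"
proof (rule is_functor_CntrI[OF category_one])
  let ?Z = "hat (inp empty_box) \<times>\<^sub>P hat (outp empty_box)"
  have "presheaf ?Z"
    by (simp add: presheaf_prod presheaf_hat typed_finite_set_empty empty_box_def)
  then have "sub_presheaf ?Z (\<lambda>l \<in> Ob Int_cat. sect ?Z l)"
    by (intro sub_presheaf_restrictI restr_closed subset_refl)
  then show "sub_presheaf ?Z (fob Cntr_unit a)" for a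
    by (simp add: Cntr_unit_def)
qed (simp add: Cntr_unit_def)


section \<open>Contracted machines\<close>

text \<open>Factoring through a sub-presheaf is a condition on values alone: the factorisation, if it
  exists, is \<open>p\<close> itself with a smaller codomain.\<close>

lemma validates_iff:
  assumes p: "psh_map S (A \<times>\<^sub>P B) p"
  shows "validates A B (S, p) C \<longleftrightarrow> (\<forall>l \<ge> 0. \<forall>s \<in> sect S l. p l s \<in> C l)"
proof
  let ?C = "sub_psh (A \<times>\<^sub>P B) C"
  assume "validates A B (S, p) C"
  then obtain g where g: "psh_map S ?C g" and eq: "p = comp_map S (id_map ?C) g"
    by (auto simp: validates_def)
  show "\<forall>l \<ge> 0. \<forall>s \<in> sect S l. p l s \<in> C l"
    using psh_map_closed[OF g] by (auto simp: eq) (simp add: sub_psh_def)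
next
  let ?C = "sub_psh (A \<times>\<^sub>P B) C"
  assume R: "\<forall>l \<ge> 0. \<forall>s \<in> sect S l. p l s \<in> C l"
  have "psh_map S ?C p"
    by (rule psh_map_codomain[OF p]) (use R in \<open>simp_all add: sub_psh_def\<close>)
  moreover have "comp_map S (id_map ?C) p = p"
    by (rule comp_map_eqI[OF p]) (use R in \<open>simp add: sub_psh_def\<close>)
  ultimately show "validates A B (S, p) C"
    by (auto simp: validates_def)
qed

lemma Mch_ObD: "(S, p) \<in> Ob (Mch A B) \<Longrightarrow> psh_map S (A \<times>\<^sub>P B) p"
  by (simp add: Mch_def slice_def)

text \<open>A state of the wired machine is a pair \<open>(s, w)\<close> with \<open>p s = h w\<close>. As \<open>p s\<close> obeys the contract, \<open>w\<close>
  lies in the contract pulled back along \<open>h\<close>, and the output of the state lies in its image.\<close>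

lemma validates_wire:
  assumes M: "(S, p) \<in> Ob (Mch_box X)" and M': "fob (Mch_wire X Y \<phi>) (S, p) \<in> Ob (Mch_box Y)"
    and val: "validates (hat (inp X)) (hat (outp X)) (S, p) C"
  shows "validates (hat (inp Y)) (hat (outp Y)) (fob (Mch_wire X Y \<phi>) (S, p)) (fob (Cntr_wire X Y \<phi>) C)"
proof -
  let ?P = "pullback S (mid X Y) p (wire_in X Y \<phi>)"
  obtain q where M_eq: "fob (Mch_wire X Y \<phi>) (S, p) = (?P, q)"
    and q: "\<And>l s w. \<lbrakk>0 \<le> l; (s, w) \<in> sect ?P l\<rbrakk> \<Longrightarrow> q l (s, w) = wire_out X Y \<phi> l w"
    by (simp add: Mch_wire_def fcomp_def slice_post_def slice_pull_def)
  have "p l s \<in> C l" if "0 \<le> l" "s \<in> sect S l" for l s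
    using val that by (simp add: validates_iff[OF Mch_ObD[OF M]])
  then have "q l (s, w) \<in> fob (Cntr_wire X Y \<phi>) C l" if "0 \<le> l" "(s, w) \<in> sect ?P l" for l s w
    unfolding q[OF that] using that
    by (auto simp: Cntr_wire_def fcomp_def sub_image_def sub_pull_def simp del: sect_prod intro!: imageI)
      metis
  then show ?thesis
    unfolding M_eq validates_iff[OF Mch_ObD[OF M'[unfolded M_eq]]] by auto
qed

lemma validates_lax:
  assumes M: "(S, p) \<in> Ob (Mch_box X\<^sub>1)" and N: "(T, q) \<in> Ob (Mch_box X\<^sub>2)"
    and M': "fob (Mch_lax X\<^sub>1 X\<^sub>2) ((S, p), (T, q)) \<in> Ob (Mch_box (X\<^sub>1 \<oplus>\<^sub>B X\<^sub>2))"
    and val: "validates (hat (inp X\<^sub>1)) (hat (outp X\<^sub>1)) (S, p) C"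
      "validates (hat (inp X\<^sub>2)) (hat (outp X\<^sub>2)) (T, q) D"
  shows "validates (hat (inp (X\<^sub>1 \<oplus>\<^sub>B X\<^sub>2))) (hat (outp (X\<^sub>1 \<oplus>\<^sub>B X\<^sub>2)))
    (fob (Mch_lax X\<^sub>1 X\<^sub>2) ((S, p), (T, q))) (fob (Cntr_lax X\<^sub>1 X\<^sub>2) (C, D))"
proof -
  have M_eq: "fob (Mch_lax X\<^sub>1 X\<^sub>2) ((S, p), (T, q))
      = (S \<times>\<^sub>P T, comp_map (S \<times>\<^sub>P T) (box_sum X\<^sub>1 X\<^sub>2) (prod_map S T p q))"
    by (simp add: Mch_lax_def)
  have "p l s \<in> C l" "q l t \<in> D l" if "0 \<le> l" "s \<in> sect S l" "t \<in> sect T l" for l s t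
    using val that by (simp_all add: validates_iff[OF Mch_ObD[OF M]] validates_iff[OF Mch_ObD[OF N]])
  then show ?thesis
    unfolding M_eq validates_iff[OF Mch_ObD[OF M'[unfolded M_eq]]] by (auto simp: Cntr_lax_def)
qed

lemma validates_full:
  assumes M: "M \<in> Ob (Mch A B)" and C: "\<And>l. 0 \<le> l \<Longrightarrow> sect (A \<times>\<^sub>P B) l \<subseteq> C l"
  shows "validates A B M C"
proof -
  obtain S p where M_eq: "M = (S, p)" by fastforce
  note p = Mch_ObD[OF M[unfolded M_eq]]
  show ?thesis
    unfolding M_eq validates_iff[OF p] using psh_map_closed[OF p] C by blast
qed

theorem proposition4p5p5:
  shows
    "(\<forall>(X :: ('i, 'a) box) (Y :: ('j, 'a) box) \<phi>.
        is_box X \<longrightarrow> is_box Y \<longrightarrow> wiring_diagram X Y \<phi> \<longrightarrow>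
        restricts (Mch_box X \<times>\<^sub>C Cntr_box X) (CM_box X)
                  (Mch_box Y \<times>\<^sub>C Cntr_box Y) (CM_box Y)
          (MC_wire X Y \<phi>)) \<and>
     (\<forall>(X\<^sub>1 :: ('i, 'a) box) (X\<^sub>2 :: ('j, 'a) box).
        is_box X\<^sub>1 \<longrightarrow> is_box X\<^sub>2 \<longrightarrow>
        restricts ((Mch_box X\<^sub>1 \<times>\<^sub>C Cntr_box X\<^sub>1) \<times>\<^sub>C (Mch_box X\<^sub>2 \<times>\<^sub>C Cntr_box X\<^sub>2)) (CM_box X\<^sub>1 \<times>\<^sub>C CM_box X\<^sub>2)
                  (Mch_box (X\<^sub>1 \<oplus>\<^sub>B X\<^sub>2) \<times>\<^sub>C Cntr_box (X\<^sub>1 \<oplus>\<^sub>B X\<^sub>2)) (CM_box (X\<^sub>1 \<oplus>\<^sub>B X\<^sub>2))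
          (MC_lax X\<^sub>1 X\<^sub>2)) \<and>
     restricts one_cat one_cat
               (Mch_box (empty_box :: ('i, 'a) box) \<times>\<^sub>C Cntr_box (empty_box :: ('i, 'a) box))
               (CM_box (empty_box :: ('i, 'a) box))
       MC_unit"
proof (intro conjI allI impI)
  fix X :: "('i, 'a) box" and Y :: "('j, 'a) box" and \<phi>
  assume box: "is_box X" "is_box Y" "wiring_diagram X Y \<phi>"
  note F = is_functor_Mch_wire[OF box]
  show "restricts (Mch_box X \<times>\<^sub>C Cntr_box X) (CM_box X) (Mch_box Y \<times>\<^sub>C Cntr_box Y) (CM_box Y) (MC_wire X Y \<phi>)"
    unfolding CM_def MC_wire_def
    by (rule restricts_full_subcat[OF is_functor_prod[OF F is_functor_Cntr_wire[OF box]]])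
      (auto simp: prod_cat_def prod_fctr_def intro!: validates_wire is_functor.fob_closed[OF F])
next
  fix X\<^sub>1 :: "('i, 'a) box" and X\<^sub>2 :: "('j, 'a) box"
  assume box: "is_box X\<^sub>1" "is_box X\<^sub>2"
  note F = is_functor_Mch_lax[OF box]
  have cat: "category (Mch A B)" for A B
    by (simp add: Mch_def category_slice)
  show "restricts ((Mch_box X\<^sub>1 \<times>\<^sub>C Cntr_box X\<^sub>1) \<times>\<^sub>C (Mch_box X\<^sub>2 \<times>\<^sub>C Cntr_box X\<^sub>2)) (CM_box X\<^sub>1 \<times>\<^sub>C CM_box X\<^sub>2)
      (Mch_box (X\<^sub>1 \<oplus>\<^sub>B X\<^sub>2) \<times>\<^sub>C Cntr_box (X\<^sub>1 \<oplus>\<^sub>B X\<^sub>2)) (CM_box (X\<^sub>1 \<oplus>\<^sub>B X\<^sub>2)) (MC_lax X\<^sub>1 X\<^sub>2)"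
    unfolding CM_def MC_lax_def prod_full_subcat
    by (rule restricts_full_subcat[OF is_functor_fcomp[OF
          is_functor_interchange[OF cat category_Cntr cat category_Cntr]
          is_functor_prod[OF F is_functor_Cntr_lax[OF box]]]])
      (auto simp: prod_cat_def prod_fctr_def fcomp_def interchange_def
        intro!: validates_lax is_functor.fob_closed[OF F, unfolded prod_cat_def, simplified])
next
  note F = is_functor_Mch_unit
  \<comment> \<open>The one-object category is presented as a full subcategory of itself, so that the general
    criterion applies to the unit as well.\<close>
  have "restricts one_cat (full_subcat one_cat (\<lambda>_. True))
      (Mch_box (empty_box :: ('i, 'a) box) \<times>\<^sub>C Cntr_box (empty_box :: ('i, 'a) box))
      (CM_box (empty_box :: ('i, 'a) box)) MC_unit"
    unfolding CM_def MC_unit_def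
    by (rule restricts_full_subcat[OF is_functor_pair[OF F is_functor_Cntr_unit]])
      (auto simp: pair_fctr_def Cntr_unit_def intro!: validates_full is_functor.fob_closed[OF F])
  then show "restricts one_cat one_cat
      (Mch_box (empty_box :: ('i, 'a) box) \<times>\<^sub>C Cntr_box (empty_box :: ('i, 'a) box))
      (CM_box (empty_box :: ('i, 'a) box)) MC_unit"
    by (simp add: full_subcat_True)
qed

end
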